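(* Let $n$ be a positive integer and $V_n$ the elementary abelian $2$-group of order $2^n$. There is an isomorphism of $GL_n(\mathbb{F}_2)$-modules $$H^3(V_n,k^\times)\cong\mathsf{S}^3(x_1,\dots,x_n)\big/\mathbb{F}_2\langle x_i^2x_j+x_ix_j^2\mid i,j=1,\dots,n\rangle .$$
   Context: $k$ is an algebraically closed field of characteristic $0$. $V_n$ is viewed as an $n$-dimensional $\mathbb{F}_2$-vector space, $\mathsf{Aut}(V_n)=GL_n(\mathbb{F}_2)$, and $x_1,\dots,x_n$ is the basis of $V_n^*=\mathrm{Hom}(V_n,\mathbb{F}_2)$ consisting of coordinate functions $x_i(v)=v_i$. $\mathsf{S}^3(x_1,\dots,x_n)=\mathsf{S}^3(V_n^* )$ is the space of homogeneous polynomials of degree $3$ over $\mathbb{F}_2$ in $x_1,\dots,x_n$, and $\mathbb{F}_2\langle\cdots\rangle$ denotes the $\mathbb{F}_2$-span (which is a $GL_n(\mathbb{F}_2)$-submodule). $H^3(V_n,k^\times)$ is group cohomology with trivial action on $k^\times$. *)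

theory Defs
  imports
    "HOL-Analysis.Analysis"
    "HOL-Algebra.Coset"
    "HOL-Algebra.FiniteProduct"
    "HOL-Computational_Algebra.Polynomial"
    "HOL-Library.Poly_Mapping"
    "HOL-Library.Z2"
begin

definition group_module ::
    "('g, 'p) monoid_scheme \<Rightarrow> ('m, 'q) monoid_scheme \<Rightarrow> ('g \<Rightarrow> 'm \<Rightarrow> 'm) \<Rightarrow> bool" where
  "group_module \<Gamma> M act \<longleftrightarrow>
     Group.group \<Gamma> \<and> comm_group M \<and>
     (\<forall>g \<in> carrier \<Gamma>. act g \<in> hom M M) \<and>
     (\<forall>x \<in> carrier M. act \<one>\<^bsub>\<Gamma>\<^esub> x = x) \<and>
     (\<forall>g \<in> carrier \<Gamma>. \<forall>h \<in> carrier \<Gamma>. \<forall>x \<in> carrier M.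
        act (g \<otimes>\<^bsub>\<Gamma>\<^esub> h) x = act g (act h x))"

definition group_module_isomorphic ::
    "('g, 'p) monoid_scheme \<Rightarrow> ('m, 'q) monoid_scheme \<Rightarrow> ('g \<Rightarrow> 'm \<Rightarrow> 'm) \<Rightarrow>
     ('n, 'r) monoid_scheme \<Rightarrow> ('g \<Rightarrow> 'n \<Rightarrow> 'n) \<Rightarrow> bool" where
  "group_module_isomorphic \<Gamma> M act N act' \<longleftrightarrow>
     group_module \<Gamma> M act \<and> group_module \<Gamma> N act' \<and>
     (\<exists>\<phi> \<in> Group.iso M N. \<forall>g \<in> carrier \<Gamma>. \<forall>x \<in> carrier M. \<phi> (act g x) = act' g (\<phi> x))"

text \<open>Cohomology of the complex of inhomogeneous cochains. An \<open>n\<close>-cochain is a function on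
  lists of length \<open>n\<close> over \<open>G\<close>, extensional outside of them; the coefficient group \<open>A\<close> is
  written multiplicatively.\<close>

definition tuples :: "('g, 'p) monoid_scheme \<Rightarrow> nat \<Rightarrow> 'g list set" where
  "tuples G n = {xs. set xs \<subseteq> carrier G \<and> length xs = n}"

definition cochain_group ::
    "('g, 'p) monoid_scheme \<Rightarrow> ('a, 'q) monoid_scheme \<Rightarrow> nat \<Rightarrow> ('g list \<Rightarrow> 'a) monoid" where
  "cochain_group G A n =
     \<lparr>carrier = tuples G n \<rightarrow>\<^sub>E carrier A,
      monoid.mult = (\<lambda>f h. \<lambda>xs \<in> tuples G n. f xs \<otimes>\<^bsub>A\<^esub> h xs),
      one = (\<lambda>xs \<in> tuples G n. \<one>\<^bsub>A\<^esub>)\<rparr>"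

definition merge_at :: "('g, 'p) monoid_scheme \<Rightarrow> nat \<Rightarrow> 'g list \<Rightarrow> 'g list" where
  "merge_at G i xs = take i xs @ (xs ! i \<otimes>\<^bsub>G\<^esub> xs ! Suc i) # drop (Suc (Suc i)) xs"

text \<open>In additive notation, for \<open>xs = [g\<^sub>0, \<dots>, g\<^sub>n]\<close>:
  \<open>(d f) xs = f [g\<^sub>1, \<dots>, g\<^sub>n] + (\<Sum>i<n. (-1)^(i+1) f [\<dots>, g\<^sub>i g\<^sub>i\<^sub>+\<^sub>1, \<dots>]) + (-1)^(n+1) f [g\<^sub>0, \<dots>, g\<^sub>n\<^sub>-\<^sub>1]\<close>.\<close>

definition coboundary ::
    "('g, 'p) monoid_scheme \<Rightarrow> ('a, 'q) monoid_scheme \<Rightarrow> nat \<Rightarrow> ('g list \<Rightarrow> 'a) \<Rightarrow> 'g list \<Rightarrow> 'a" where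
  "coboundary G A n f = (\<lambda>xs \<in> tuples G (Suc n).
     f (tl xs)
     \<otimes>\<^bsub>A\<^esub> finprod A (\<lambda>i. f (merge_at G i xs) [^]\<^bsub>A\<^esub> ((- 1) ^ Suc i :: int)) {..<n}
     \<otimes>\<^bsub>A\<^esub> f (butlast xs) [^]\<^bsub>A\<^esub> ((- 1) ^ Suc n :: int))"

definition cocycles ::
    "('g, 'p) monoid_scheme \<Rightarrow> ('a, 'q) monoid_scheme \<Rightarrow> nat \<Rightarrow> ('g list \<Rightarrow> 'a) set" where
  "cocycles G A n = kernel (cochain_group G A n) (cochain_group G A (Suc n)) (coboundary G A n)"

definition coboundaries ::
    "('g, 'p) monoid_scheme \<Rightarrow> ('a, 'q) monoid_scheme \<Rightarrow> nat \<Rightarrow> ('g list \<Rightarrow> 'a) set" where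
  "coboundaries G A n =
     (case n of 0 \<Rightarrow> {\<one>\<^bsub>cochain_group G A 0\<^esub>}
      | Suc m \<Rightarrow> coboundary G A m ` carrier (cochain_group G A m))"

definition group_cohomology ::
    "('g, 'p) monoid_scheme \<Rightarrow> ('a, 'q) monoid_scheme \<Rightarrow> nat \<Rightarrow> ('g list \<Rightarrow> 'a) set monoid" where
  "group_cohomology G A n =
     (cochain_group G A n)\<lparr>carrier := cocycles G A n\<rparr> Mod coboundaries G A n"

definition pullback_cochain ::
    "('g, 'p) monoid_scheme \<Rightarrow> nat \<Rightarrow> ('g \<Rightarrow> 'g) \<Rightarrow> ('g list \<Rightarrow> 'a) \<Rightarrow> 'g list \<Rightarrow> 'a" where
  "pullback_cochain G n \<alpha> f = (\<lambda>xs \<in> tuples G n. f (map \<alpha> xs))"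

text \<open>A cohomology class is a coset, and for an automorphism \<open>\<alpha>\<close> of \<open>G\<close> its pullback is the
  image of that coset.\<close>

definition pullback_cohomology ::
    "('g, 'p) monoid_scheme \<Rightarrow> nat \<Rightarrow> ('g \<Rightarrow> 'g) \<Rightarrow> ('g list \<Rightarrow> 'a) set \<Rightarrow> ('g list \<Rightarrow> 'a) set" where
  "pullback_cohomology G n \<alpha> c = pullback_cochain G n \<alpha> ` c"

text \<open>\<open>F\<^sub>2\<close> is the type \<open>bit\<close> and \<open>V\<^sub>n\<close> is \<open>bit ^ 'n\<close> with \<open>n = CARD('n)\<close>; the coordinates
  are indexed by \<open>'n\<close>.\<close>

definition unit_group :: "'k::field monoid" where
  "unit_group = \<lparr>carrier = {a. a \<noteq> 0}, monoid.mult = (*), one = 1\<rparr>"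

definition V_group :: "(bit ^ 'n) monoid" where
  "V_group = \<lparr>carrier = UNIV, monoid.mult = (+), one = 0\<rparr>"

definition GL_group :: "(bit ^ 'n ^ 'n) monoid" where
  "GL_group = \<lparr>carrier = {A. invertible A}, monoid.mult = (**), one = mat 1\<rparr>"

text \<open>Left action \<open>(A \<cdot> f) [v\<^sub>1, \<dots>, v\<^sub>m] = f [A\<inverse>v\<^sub>1, \<dots>, A\<inverse>v\<^sub>m]\<close>.\<close>

definition GL_cohomology_action ::
    "nat \<Rightarrow> bit ^ 'n ^ 'n \<Rightarrow> ((bit ^ 'n) list \<Rightarrow> 'a) set \<Rightarrow> ((bit ^ 'n) list \<Rightarrow> 'a) set" where
  "GL_cohomology_action m A = pullback_cohomology V_group m (\<lambda>v. matrix_inv A *v v)"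

text \<open>Formal polynomials: finitely supported functions from exponent vectors to \<open>F\<^sub>2\<close>, with the
  convolution product.\<close>

type_synonym 'n F2_poly = "('n \<Rightarrow>\<^sub>0 nat) \<Rightarrow>\<^sub>0 bit"

definition const_poly :: "bit \<Rightarrow> 'n F2_poly" where
  "const_poly c = Poly_Mapping.single 0 c"

definition X :: "'n \<Rightarrow> 'n F2_poly" where
  "X i = Poly_Mapping.single (Poly_Mapping.single i 1) 1"

definition homogeneous_polys :: "nat \<Rightarrow> ('n::finite) F2_poly set" where
  "homogeneous_polys d =
     {p. \<forall>m \<in> Poly_Mapping.keys p. (\<Sum>i \<in> UNIV. Poly_Mapping.lookup m i) = d}"

definition substitute :: "('n::finite \<Rightarrow> 'n F2_poly) \<Rightarrow> 'n F2_poly \<Rightarrow> 'n F2_poly" where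
  "substitute \<sigma> p = (\<Sum>m \<in> Poly_Mapping.keys p.
     const_poly (Poly_Mapping.lookup p m) * (\<Prod>i \<in> UNIV. \<sigma> i ^ Poly_Mapping.lookup m i))"

text \<open>The action on the dual space is \<open>A \<cdot> x\<^sub>i = x\<^sub>i \<circ> A\<inverse> = (\<Sum>j. (A\<inverse>)\<^sub>i\<^sub>j x\<^sub>j)\<close>; it extends to
  polynomials multiplicatively.\<close>

definition GL_poly_action :: "bit ^ 'n ^ 'n \<Rightarrow> ('n::finite) F2_poly \<Rightarrow> 'n F2_poly" where
  "GL_poly_action A = substitute (\<lambda>i. \<Sum>j \<in> UNIV. const_poly (matrix_inv A $ i $ j) * X j)"

definition S3_group :: "('n::finite) F2_poly monoid" where
  "S3_group = \<lparr>carrier = homogeneous_polys 3, monoid.mult = (+), one = 0\<rparr>"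

definition S3_relations :: "('n::finite) F2_poly set" where
  "S3_relations = module.span (\<lambda>c p. const_poly c * p) {X i ^ 2 * X j + X i * X j ^ 2 | i j. True}"

definition S3_quotient :: "('n::finite) F2_poly set monoid" where
  "S3_quotient = S3_group Mod S3_relations"

definition GL_S3_quotient_action ::
    "bit ^ 'n ^ 'n \<Rightarrow> ('n::finite) F2_poly set \<Rightarrow> 'n F2_poly set" where
  "GL_S3_quotient_action A c = GL_poly_action A ` c"

end

theory Submission
  imports Defs
begin

text \<open>A 3-cocycle \<open>f\<close> on \<open>V\<close> restricts to each cyclic subgroup \<open>{0, v}\<close>, where its class is the sign
  \<open>f(v, 0, v) f(v, v, v)\<close>; this gives an equivariant homomorphism from \<open>H\<^sup>3(V, k\<^sup>\<times>)\<close> to the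
  \<open>k\<^sup>\<times>\<close>-valued functions on \<open>V\<close>. A cubic form \<open>p\<close> gives the function \<open>v \<mapsto> (-1)\<^bsup>p(v)\<^esup>\<close>, and the
  cubic forms that vanish at every point are exactly the span of the \<open>x\<^sub>i\<^sup>2 x\<^sub>j + x\<^sub>i x\<^sub>j\<^sup>2\<close>.
  So it suffices that the first map is injective and that both have the same image.
  Splitting off one coordinate \<open>x\<^sub>i\<close> at a time, the Eilenberg--Zilber homotopy shows that \<open>f\<close> is
  cohomologous to \<open>f' + q \<union> x\<^sub>i + s x\<^sub>i\<^sup>3\<close> with \<open>f'\<close> and the 2-torsion 2-cocycle \<open>q\<close> independent of
  \<open>x\<^sub>i\<close>. Both \<open>s\<close> and the diagonal of \<open>q\<close> can be read off the diagonal of \<open>f\<close>, so induction on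
  the coordinates shows that the diagonal is a cubic function and that it determines the
  class.\<close>

section \<open>Cocycles and the Eilenberg--Zilber homotopy\<close>

text \<open>Testing a class on cyclic subgroups is delicate. With coefficients {1, -1} the
  corresponding test is not injective in degree 3: for distinct i, j the class of x_i^2 x_j + x_i
  x_j^2 is nonzero, yet this form vanishes at every point. In degree 2 the test does work, because a
  quadratic form over F_2 is determined by its values. So the induction must arrive in degree 2 with
  a cocycle killed by 2. The shuffle alone does not deliver it: its coefficient of x_i, doubled, is
  minus the coboundary of another shuffle term \<open>f1\<close>. Since every element of the unit
  group is a square, \<open>f1\<close> can be halved, and adding the coboundary of the half gives
  the 2-torsion cocycle. The exceptional cubic forms become coboundaries for the same reason, once
  the coefficients grow from {1, -1} to all units. Cochains are curried and additive, so that a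
  cocycle identity is a linear relation between values; most proofs below exhibit the combination of
  cocycle instances that yields it.\<close>

definition cob1 :: "('v::ab_group_add \<Rightarrow> 'a::ab_group_add) \<Rightarrow> 'v \<Rightarrow> 'v \<Rightarrow> 'a" where
  "cob1 c u v = c v - c (u + v) + c u"

definition cob2 :: "('v::ab_group_add \<Rightarrow> 'v \<Rightarrow> 'a::ab_group_add) \<Rightarrow> 'v \<Rightarrow> 'v \<Rightarrow> 'v \<Rightarrow> 'a" where
  "cob2 g u v w = g v w - g (u + v) w + g u (v + w) - g u v"

definition cob3 :: "('v::ab_group_add \<Rightarrow> 'v \<Rightarrow> 'v \<Rightarrow> 'a::ab_group_add) \<Rightarrow> 'v \<Rightarrow> 'v \<Rightarrow> 'v \<Rightarrow> 'v \<Rightarrow> 'a" where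
  "cob3 f u v w z = f v w z - f (u + v) w z + f u (v + w) z - f u v (w + z) + f u v w"

definition normalized2 :: "('v::zero \<Rightarrow> 'v \<Rightarrow> 'a::zero) \<Rightarrow> bool" where
  "normalized2 f \<longleftrightarrow> (\<forall>a. f 0 a = 0 \<and> f a 0 = 0)"

definition normalized3 :: "('v::zero \<Rightarrow> 'v \<Rightarrow> 'v \<Rightarrow> 'a::zero) \<Rightarrow> bool" where
  "normalized3 f \<longleftrightarrow> (\<forall>a b. f 0 a b = 0 \<and> f a 0 b = 0 \<and> f a b 0 = 0)"

text \<open>Multiplication by the representative 0 or 1 of a bit. It is additive in the bit on
  2-torsion elements; on other elements the carry in 1 + 1 = 0 costs \<open>a + a\<close>, which
  \<open>split_3_cocycle\<close> exploits.\<close>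

definition scale_bit :: "bit \<Rightarrow> 'a::zero \<Rightarrow> 'a" where
  "scale_bit b a = (if b = 1 then a else 0)"

lemma scale_bit_simps [simp]:
  "scale_bit 0 a = 0" "scale_bit 1 a = a" "scale_bit b 0 = 0"
  by (auto simp: scale_bit_def)

lemma scale_bit_add_left:
  fixes a :: "'a::ab_group_add"
  assumes "a + a = 0"
  shows "scale_bit (b + c) a = scale_bit b a + scale_bit c a"
  using assms by (cases b; cases c; simp)

lemma cob3_cob2: "cob3 (cob2 g) u v w z = 0"
  by (simp add: cob3_def cob2_def algebra_simps)

lemma cob2_cob1: "cob2 (cob1 c) u v w = 0"
  by (simp add: cob2_def cob1_def algebra_simps)

text \<open>The Eilenberg--Zilber homotopy between the identity and the shuffle of the
  Alexander--Whitney decomposition, evaluated on a cocycle; the points are \<open>h\<^sub>i + k\<^sub>i\<close>, and the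
  last bracket is the coboundary of the homotopy term.\<close>

lemma shuffle_2_cocycle:
  assumes "\<And>u v w. cob2 f u v w = 0"
  shows "f (h1 + k1) (h2 + k2) =
    f h1 h2 + (f h1 k2 - f k2 h1) + f k1 k2 - (f k2 h2 - f (k1 + k2) (h1 + h2) + f k1 h1)"
proof -
  have "f (h1 + k1) (h2 + k2) - (f h1 h2 + (f h1 k2 - f k2 h1) + f k1 k2
      - (f k2 h2 - f (k1 + k2) (h1 + h2) + f k1 h1)) =
    cob2 f (h1 + k1) k2 h2 - cob2 f (k1 + k2) h1 h2 - cob2 f k1 h1 k2 + cob2 f k1 k2 h1"
    by (simp add: cob2_def algebra_simps)
  then show ?thesis
    by (simp add: assms)
qed

lemma shuffle_3_cocycle:
  assumes "\<And>u v w z. cob3 f u v w z = 0"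
  defines "g \<equiv> \<lambda>h1 k1 h2 k2. f (h1 + k1) k2 h2 - f (k1 + k2) h1 h2 - f k1 h1 k2 + f k1 k2 h1"
  shows "f (h1 + k1) (h2 + k2) (h3 + k3) =
    f h1 h2 h3 + (f h1 h2 k3 - f h1 k3 h2 + f k3 h1 h2)
    + (f h1 k2 k3 - f k2 h1 k3 + f k2 k3 h1) + f k1 k2 k3
    + (g h2 k2 h3 k3 - g (h1 + h2) (k1 + k2) h3 k3 + g h1 k1 (h2 + h3) (k2 + k3) - g h1 k1 h2 k2)"
proof -
  \<comment> \<open>The eleven signed 4-tuples are the degree 3 homotopy applied to
    \<open>(h1 + k1, h2 + k2, h3 + k3)\<close>. The four signed 3-tuples in \<open>g\<close> are the
    degree 2 homotopy, the same four at which \<open>shuffle_2_cocycle\<close> uses the cocycle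
    condition.\<close>
  have "f (h1 + k1) (h2 + k2) (h3 + k3) -
    (f h1 h2 h3 + (f h1 h2 k3 - f h1 k3 h2 + f k3 h1 h2)
    + (f h1 k2 k3 - f k2 h1 k3 + f k2 k3 h1) + f k1 k2 k3
    + (g h2 k2 h3 k3 - g (h1 + h2) (k1 + k2) h3 k3 + g h1 k1 (h2 + h3) (k2 + k3) - g h1 k1 h2 k2)) =
    - cob3 f (h1 + k1) (h2 + k2) k3 h3 + cob3 f (h1 + k1) (k2 + k3) h2 h3
    - cob3 f (k1 + k2 + k3) h1 h2 h3 + cob3 f (h1 + k1) k2 h2 k3 - cob3 f (h1 + k1) k2 k3 h2
    - cob3 f (k1 + k2) h1 h2 k3 + cob3 f (k1 + k2) h1 k3 h2 - cob3 f (k1 + k2) k3 h1 h2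
    - cob3 f k1 h1 k2 k3 + cob3 f k1 k2 h1 k3 - cob3 f k1 k2 k3 h1"
    unfolding cob3_def g_def by (simp add: algebra_simps)
  then show ?thesis
    by (simp add: assms(1))
qed

text \<open>The mixed shuffle \<open>l\<close> is the commutator pairing with \<open>t\<close> in
  the central extension that \<open>f\<close> defines, hence additive. All outputs inherit 2-torsion
  from the values of \<open>f\<close>.\<close>

lemma split_2_cocycle:
  fixes f :: "'v::ab_group_add \<Rightarrow> 'v \<Rightarrow> 'a::ab_group_add"
  assumes f: "\<And>u v w. cob2 f u v w = 0" "normalized2 f" "\<And>u v. f u v + f u v = 0"
    and t: "t + t = 0"
    and P: "\<And>u v. P (u + v) = P u + P v" and x: "\<And>u v. x (u + v) = x u + x v"
  obtains l s c where "\<And>a b. l (a + b) = l a + l b" "\<And>a. l a + l a = 0" "s + s = 0"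
    "\<And>u. c u + c u = 0"
    "\<And>u v. f (P u + scale_bit (x u) t) (P v + scale_bit (x v) t) =
       f (P u) (P v) + scale_bit (x v) (l (P u)) + scale_bit (x u * x v) s + cob1 c u v"
proof -
  have f0: "f 0 a = 0" "f a 0 = 0" for a
    using f(2) by (auto simp: normalized2_def)
  define k where "k u = scale_bit (x u) t" for u
  have k: "k (u + v) = k u + k v" for u v
    unfolding k_def x by (rule scale_bit_add_left[OF t])
  define l where "l a = f a t - f t a" for a
  \<comment> \<open>The homotopy bracket of \<open>shuffle_2_cocycle\<close> is subtracted there,
    hence the sign.\<close>
  define c where "c u = - f (k u) (P u)" for u
  have neg: "- f a b = f a b" for a b
    using f(3)[of a b] by (metis add_eq_0_iff2)
  show thesis
  proof
    show "l (a + b) = l a + l b" for a b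
    proof -
      \<comment> \<open>These are the three signed shuffles of \<open>(a, b)\<close> with
        \<open>t\<close>.\<close>
      have "l (a + b) - (l a + l b) = - cob2 f a b t + cob2 f a t b - cob2 f t a b"
        by (simp add: l_def cob2_def algebra_simps)
      then show ?thesis by (simp add: f(1))
    qed
    show "l a + l a = 0" for a
    proof -
      have "l a + l a = (f a t + f a t) - (f t a + f t a)"
        by (simp add: l_def algebra_simps)
      then show ?thesis by (simp add: f(3))
    qed
    show "f t t + f t t = 0" by (rule f(3))
    show "c u + c u = 0" for u
      using f(3)[of "k u" "P u"] by (simp add: c_def neg)
    show "f (P u + scale_bit (x u) t) (P v + scale_bit (x v) t) =
       f (P u) (P v) + scale_bit (x v) (l (P u)) + scale_bit (x u * x v) (f t t) + cob1 c u v" for u v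
      unfolding k_def[symmetric] shuffle_2_cocycle[OF f(1), of "P u" "k u" "P v" "k v"]
      unfolding cob1_def c_def k P
      by (cases "x u"; cases "x v"; simp add: k_def l_def f0 algebra_simps)
  qed
qed

text \<open>For the splitting \<open>v = P v + x v \<cdot> t\<close> the shuffle produces a cup product with \<open>x\<close>, one with
  \<open>x\<^sup>2\<close>, and a multiple of \<open>x\<^sup>3\<close>. Halving the second coefficient \<open>f1\<close> moves it into the first
  one, which thereby becomes 2-torsion.\<close>

lemma split_3_cocycle:
  fixes f :: "'v::ab_group_add \<Rightarrow> 'v \<Rightarrow> 'v \<Rightarrow> 'a::ab_group_add"
  assumes f: "\<And>u v w z. cob3 f u v w z = 0" "normalized3 f"
    and div: "\<And>a :: 'a. \<exists>b. b + b = a"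
    and t: "t + t = 0"
    and P: "\<And>u v. P (u + v) = P u + P v" and x: "\<And>u v. x (u + v) = x u + x v"
  obtains q s g where "\<And>u v w. cob2 q u v w = 0" "normalized2 q" "\<And>u v. q u v + q u v = 0"
    "s + s = 0"
    "\<And>u v w. f (P u + scale_bit (x u) t) (P v + scale_bit (x v) t) (P w + scale_bit (x w) t) =
       f (P u) (P v) (P w) + scale_bit (x w) (q (P u) (P v)) + scale_bit (x u * x v * x w) s
       + cob2 g u v w"
proof -
  have f0: "f 0 a b = 0" "f a 0 b = 0" "f a b 0 = 0" for a b
    using f(2) by (auto simp: normalized3_def)
  have t': "t + (t + a) = a" for a
    using t by (simp flip: add.assoc)
  define k where "k u = scale_bit (x u) t" for u
  have k: "k (u + v) = k u + k v" for u v
    unfolding k_def x by (rule scale_bit_add_left[OF t])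
  \<comment> \<open>\<open>f2\<close> and \<open>f1\<close> insert one and two copies of
    \<open>t\<close> by signed shuffles; they are the coefficients of x and of x^2.\<close>
  define f2 where "f2 a b = f a b t - f a t b + f t a b" for a b
  define f1 where "f1 a = f a t t - f t a t + f t t a" for a
  \<comment> \<open>The halves are chosen pointwise. At 0, where \<open>f1\<close> vanishes, the
    half is 0, which keeps \<open>q\<close> normalized.\<close>
  define y where "y a = (if a = 0 then 0 else SOME b. b + b = f1 a)" for a
  have y: "y a + y a = f1 a" for a
    using someI_ex[OF div[of "f1 a"]] by (auto simp: y_def f1_def f0)
  define q where "q a b = f2 a b + cob1 y a b" for a b
  \<comment> \<open>The homotopy cochain of \<open>shuffle_3_cocycle\<close> at the decompositions
    \<open>P u + k u\<close> and \<open>P v + k v\<close>.\<close>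
  define g0 where "g0 u v = f (P u + k u) (k v) (P v) - f (k u + k v) (P u) (P v)
    - f (k u) (P u) (k v) + f (k u) (k v) (P u)" for u v
  define g where "g u v = g0 u v - scale_bit (x v) (y (P u))" for u v
  have cocycle: "cob2 f2 a b c = 0" for a b c
  proof -
    have "cob2 f2 a b c = cob3 f a b c t - cob3 f a b t c + cob3 f a t b c - cob3 f t a b c"
      by (simp add: f2_def cob3_def cob2_def algebra_simps)
    then show ?thesis by (simp add: f(1))
  qed
  \<comment> \<open>The six signed shuffles of \<open>(a, b)\<close> with \<open>(t, t)\<close>.
    Since \<open>t + t = 0\<close>, the boundary of \<open>(t, t)\<close> is twice \<open>t\<close>
    up to a degenerate chain; this ties the double of \<open>f2\<close> to the coboundary of
    \<open>f1\<close>.\<close>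
  have double: "f2 a b + f2 a b + cob1 f1 a b = 0" for a b
  proof -
    have "f2 a b + f2 a b + cob1 f1 a b = cob3 f a b t t - cob3 f a t b t + cob3 f a t t b
        + cob3 f t a b t - cob3 f t a t b + cob3 f t t a b"
      by (simp add: f2_def f1_def cob3_def cob1_def f0 t t' algebra_simps)
    then show ?thesis by (simp add: f(1))
  qed
  \<comment> \<open>The values of \<open>y\<close> need not be 2-torsion. When \<open>x v\<close>
    and \<open>x w\<close> are both 1, the carry loses \<open>y + y = f1\<close>, so this coboundary
    trades the x^2 term for a change of the x term by \<open>cob1 y\<close>.\<close>
  have cup: "cob2 (\<lambda>u v. scale_bit (x v) (y (P u))) u v w =
      scale_bit (x w) (cob1 y (P u) (P v)) - scale_bit (x v * x w) (f1 (P u))" for u v w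
    by (cases "x v"; cases "x w"; simp add: cob2_def cob1_def x P y[symmetric] algebra_simps)
  show thesis
  proof
    show "cob2 q a b c = 0" for a b c
    proof -
      have "cob2 q a b c = cob2 f2 a b c + cob2 (cob1 y) a b c"
        by (simp add: q_def cob2_def algebra_simps)
      then show ?thesis by (simp add: cocycle cob2_cob1)
    qed
    show "normalized2 q"
      by (auto simp: normalized2_def q_def f2_def f0 cob1_def y_def)
    show "q a b + q a b = 0" for a b
    proof -
      have "q a b + q a b = f2 a b + f2 a b + cob1 f1 a b"
        by (simp add: q_def cob1_def y[symmetric] algebra_simps)
      then show ?thesis by (simp add: double)
    qed
    show "f t t t + f t t t = 0"
      using f(1)[of t t t t] by (simp add: cob3_def t f0)
    show "f (P u + scale_bit (x u) t) (P v + scale_bit (x v) t) (P w + scale_bit (x w) t) =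
       f (P u) (P v) (P w) + scale_bit (x w) (q (P u) (P v)) + scale_bit (x u * x v * x w) (f t t t)
       + cob2 g u v w" for u v w
    proof -
      have "cob2 g u v w = cob2 g0 u v w - cob2 (\<lambda>u v. scale_bit (x v) (y (P u))) u v w"
        by (simp add: g_def cob2_def algebra_simps)
      moreover have "f (P u + k u) (P v + k v) (P w + k w) = f (P u) (P v) (P w)
          + scale_bit (x w) (f2 (P u) (P v)) + scale_bit (x v * x w) (f1 (P u))
          + scale_bit (x u * x v * x w) (f t t t) + cob2 g0 u v w"
      proof -
        have "f (P u + k u) (P v + k v) (P w + k w) = f (P u) (P v) (P w)
          + (f (P u) (P v) (k w) - f (P u) (k w) (P v) + f (k w) (P u) (P v))
          + (f (P u) (k v) (k w) - f (k v) (P u) (k w) + f (k v) (k w) (P u))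
          + f (k u) (k v) (k w) + cob2 g0 u v w"
          by (subst shuffle_3_cocycle[OF f(1)]) (simp add: cob2_def g0_def k P add.assoc)
        moreover have "f (P u) (P v) (k w) - f (P u) (k w) (P v) + f (k w) (P u) (P v) =
          scale_bit (x w) (f2 (P u) (P v))"
          by (cases "x w") (simp_all add: k_def f2_def f0)
        moreover have "f (P u) (k v) (k w) - f (k v) (P u) (k w) + f (k v) (k w) (P u) =
          scale_bit (x v * x w) (f1 (P u))"
          by (cases "x v"; cases "x w") (simp_all add: k_def f1_def f0)
        moreover have "f (k u) (k v) (k w) = scale_bit (x u * x v * x w) (f t t t)"
          by (cases "x u"; cases "x v"; cases "x w") (simp_all add: k_def f0)
        ultimately show ?thesis
          by simp
      qed
      ultimately show ?thesis
        unfolding cup k_def[symmetric]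
        by (cases "x w") (simp_all add: q_def algebra_simps)
    qed
  qed
qed

text \<open>Cocycle instances with two adjacent zeros express every degenerate value through the
  functions \<open>f a 0 0\<close> and \<open>f 0 0 b\<close>. The cochain \<open>g\<close> carries
  these on the two axes, where its coboundary cancels them.\<close>

lemma normalize_3_cocycle:
  fixes f :: "'v::ab_group_add \<Rightarrow> 'v \<Rightarrow> 'v \<Rightarrow> 'a::ab_group_add"
  assumes f: "\<And>u v w z. cob3 f u v w z = 0"
  obtains g where "normalized3 (\<lambda>u v w. f u v w + cob2 g u v w)"
proof
  define g where "g a b = (if b = 0 then f a 0 0 else 0) - (if a = 0 then f 0 0 b else 0)" for a b
  have 0: "f 0 0 0 = 0"
    using f[of 0 0 0 0] by (simp add: cob3_def)
  have 1: "f a b 0 = f (a + b) 0 0 - f b 0 0" for a b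
    using f[of a b 0 0] by (simp add: cob3_def algebra_simps)
  have 2: "f 0 a b = f 0 0 (a + b) - f 0 0 a" for a b
    using f[of 0 0 a b] by (simp add: cob3_def algebra_simps)
  have 3: "f a 0 b = f 0 0 b + f a 0 0" for a b
    using f[of a 0 0 b] by (simp add: cob3_def algebra_simps)
  show "normalized3 (\<lambda>u v w. f u v w + cob2 g u v w)"
    unfolding normalized3_def
  proof (intro allI conjI)
    fix a b
    show "f 0 a b + cob2 g 0 a b = 0"
      by (subst 2) (simp add: cob2_def g_def 0)
    show "f a 0 b + cob2 g a 0 b = 0"
      by (subst 3) (simp add: cob2_def g_def 0)
    show "f a b 0 + cob2 g a b 0 = 0"
      by (subst 1) (simp add: cob2_def g_def 0)
  qed
qed

section \<open>Polynomials over the field with two elements\<close>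

lemma bit_add_self: "(b::bit) + b = 0"
  by (cases b) simp_all

lemma F2_poly_add_self: "(p::'n F2_poly) + p = 0"
  by (rule poly_mapping_eqI) (simp only: lookup_add bit_add_self lookup_zero)

text \<open>The only nonzero coefficient is 1, so a polynomial amounts to its set of monomials; this
  is why \<open>poly_value\<close> can sum over \<open>keys\<close> without coefficients.\<close>

lemma lookup_F2_poly: "Poly_Mapping.lookup (p::'n F2_poly) m = (if m \<in> Poly_Mapping.keys p then 1 else 0)"
  using bit_not_zero_iff by (auto simp: in_keys_iff)

lemma const_poly_eq_scale_bit: "const_poly c = scale_bit c (1 :: 'n F2_poly)"
  by (cases c) (simp_all add: const_poly_def)

lemma const_poly_mult: "const_poly c * p = scale_bit c p"
  by (cases c) (simp_all add: const_poly_eq_scale_bit)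

section \<open>Evaluation of polynomials in rings with 1 + 1 = 0\<close>

definition monomial_value :: "('n::finite \<Rightarrow> 'r::comm_ring_1) \<Rightarrow> ('n \<Rightarrow>\<^sub>0 nat) \<Rightarrow> 'r" where
  "monomial_value \<sigma> m = (\<Prod>i\<in>UNIV. \<sigma> i ^ Poly_Mapping.lookup m i)"

text \<open>This is a ring homomorphism only if \<open>1 + 1 = 0\<close> in the target.\<close>

definition poly_value :: "('n::finite \<Rightarrow> 'r::comm_ring_1) \<Rightarrow> 'n F2_poly \<Rightarrow> 'r" where
  "poly_value \<sigma> p = (\<Sum>m\<in>Poly_Mapping.keys p. monomial_value \<sigma> m)"

lemma monomial_value_add: "monomial_value \<sigma> (m + n) = monomial_value \<sigma> m * monomial_value \<sigma> n"
  by (simp add: monomial_value_def lookup_add power_add prod.distrib)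

lemma monomial_value_zero [simp]: "monomial_value \<sigma> 0 = 1"
  by (simp add: monomial_value_def)

lemma monomial_value_single [simp]:
  "monomial_value \<sigma> (Poly_Mapping.single i k) = \<sigma> i ^ k"
proof -
  have "monomial_value \<sigma> (Poly_Mapping.single i k) = (\<Prod>j\<in>UNIV. if j = i then \<sigma> i ^ k else 1)"
    unfolding monomial_value_def by (rule prod.cong) (auto simp: lookup_single when_def)
  then show ?thesis
    by (simp add: prod.delta)
qed

text \<open>Cancellation can shrink the support of a sum, so additivity of evaluation requires a
  common index set for all the polynomials involved.\<close>

lemma poly_value_eq_sum:
  assumes "finite F" "Poly_Mapping.keys p \<subseteq> F"
  shows "poly_value \<sigma> p = (\<Sum>m\<in>F. scale_bit (Poly_Mapping.lookup p m) (monomial_value \<sigma> m))"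
proof -
  have "(\<Sum>m\<in>F. scale_bit (Poly_Mapping.lookup p m) (monomial_value \<sigma> m)) =
    (\<Sum>m\<in>Poly_Mapping.keys p. scale_bit (Poly_Mapping.lookup p m) (monomial_value \<sigma> m))"
    using assms by (intro sum.mono_neutral_right) (auto simp: not_in_keys_iff_lookup_eq_zero)
  also have "\<dots> = poly_value \<sigma> p"
    unfolding poly_value_def by (rule sum.cong) (simp_all add: lookup_F2_poly)
  finally show ?thesis ..
qed

lemma poly_value_zero [simp]: "poly_value \<sigma> 0 = 0"
  by (simp add: poly_value_def)

lemma poly_value_single [simp]: "poly_value \<sigma> (Poly_Mapping.single m 1) = monomial_value \<sigma> m"
  by (simp add: poly_value_def)

lemma poly_value_X [simp]: "poly_value \<sigma> (X i) = \<sigma> i"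
  by (simp add: X_def)

lemma poly_value_one [simp]: "poly_value \<sigma> 1 = 1"
  by (simp add: poly_value_def)

lemma poly_value_scale_bit: "poly_value \<sigma> (scale_bit c p) = scale_bit c (poly_value \<sigma> p)"
  by (cases c) simp_all

lemma F2_poly_eq_sum:
  fixes p :: "'n F2_poly"
  shows "p = (\<Sum>m\<in>Poly_Mapping.keys p. Poly_Mapping.single m (1::bit))"
proof (rule poly_mapping_eqI)
  fix k
  have "Poly_Mapping.lookup (\<Sum>m\<in>Poly_Mapping.keys p. Poly_Mapping.single m (1::bit)) k =
      (\<Sum>m\<in>Poly_Mapping.keys p. if m = k then 1 else 0)"
    by (simp add: lookup_sum lookup_single when_def)
  also have "\<dots> = (if k \<in> Poly_Mapping.keys p then 1 else 0)"
    by (simp add: sum.delta)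
  finally show "Poly_Mapping.lookup p k =
      Poly_Mapping.lookup (\<Sum>m\<in>Poly_Mapping.keys p. Poly_Mapping.single m (1::bit)) k"
    by (simp add: lookup_F2_poly[of p])
qed

context
  fixes \<sigma> :: "'n::finite \<Rightarrow> 'r::comm_ring_1"
  assumes char_2: "(1::'r) + 1 = 0"
begin

lemma poly_value_add: "poly_value \<sigma> (p + q) = poly_value \<sigma> p + poly_value \<sigma> q"
proof -
  have self: "(r::'r) + r = 0" for r
    using arg_cong[OF char_2, of "\<lambda>c. c * r"] by (simp add: distrib_right)
  let ?F = "Poly_Mapping.keys p \<union> Poly_Mapping.keys q"
  have "Poly_Mapping.keys (p + q) \<subseteq> ?F"
    by (rule keys_add)
  then show ?thesis
    by (simp only: poly_value_eq_sum[of ?F] finite_UnI finite_keys Un_upper1 Un_upper2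
        lookup_add scale_bit_add_left[OF self] sum.distrib)
qed

lemma poly_value_sum: "poly_value \<sigma> (\<Sum>i\<in>I. p i) = (\<Sum>i\<in>I. poly_value \<sigma> (p i))"
  by (induction I rule: infinite_finite_induct) (simp_all add: poly_value_add)

lemma poly_value_mult: "poly_value \<sigma> (p * q) = poly_value \<sigma> p * poly_value \<sigma> q"
proof -
  have "p * q = (\<Sum>m\<in>Poly_Mapping.keys p. \<Sum>n\<in>Poly_Mapping.keys q. Poly_Mapping.single (m + n) 1)"
    by (subst F2_poly_eq_sum[of p], subst F2_poly_eq_sum[of q])
      (simp add: sum_product mult_single)
  then have "poly_value \<sigma> (p * q) =
      (\<Sum>m\<in>Poly_Mapping.keys p. \<Sum>n\<in>Poly_Mapping.keys q. monomial_value \<sigma> (m + n))"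
    by (simp only: poly_value_sum poly_value_single)
  then show ?thesis
    by (simp add: monomial_value_add poly_value_def sum_product)
qed

lemma poly_value_power: "poly_value \<sigma> (p ^ k) = poly_value \<sigma> p ^ k"
  by (induction k) (simp_all add: poly_value_mult)

lemma poly_value_prod: "poly_value \<sigma> (\<Prod>i\<in>I. p i) = (\<Prod>i\<in>I. poly_value \<sigma> (p i))"
  by (induction I rule: infinite_finite_induct) (simp_all add: poly_value_mult)

lemma poly_value_substitute:
  "poly_value \<sigma> (substitute \<tau> p) = poly_value (\<lambda>i. poly_value \<sigma> (\<tau> i)) p"
proof -
  have "substitute \<tau> p = (\<Sum>m\<in>Poly_Mapping.keys p. \<Prod>i\<in>UNIV. \<tau> i ^ Poly_Mapping.lookup m i)"
    unfolding substitute_def by (rule sum.cong) (simp_all add: lookup_F2_poly const_poly_mult)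
  then show ?thesis
    by (simp only: poly_value_sum poly_value_prod poly_value_power)
      (simp only: poly_value_def monomial_value_def)
qed

end

text \<open>The polynomial ring itself satisfies 1 + 1 = 0, so substitution is evaluation there, and
  its additivity and composition law are instances of those of \<open>poly_value\<close>.\<close>

lemma substitute_eq_poly_value: "substitute \<sigma> p = poly_value \<sigma> p"
  unfolding substitute_def poly_value_def monomial_value_def
  by (rule sum.cong) (simp_all add: lookup_F2_poly const_poly_mult)

lemma substitute_add: "substitute \<sigma> (p + q) = substitute \<sigma> p + substitute \<sigma> q"
  by (simp only: substitute_eq_poly_value poly_value_add[OF F2_poly_add_self])

lemma substitute_substitute:
  "substitute \<sigma> (substitute \<tau> p) = substitute (\<lambda>i. substitute \<sigma> (\<tau> i)) p"
  using poly_value_substitute[OF F2_poly_add_self, of \<sigma> \<tau> p]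
  by (simp only: substitute_eq_poly_value)

lemma monomial_value_X: "monomial_value X m = Poly_Mapping.single m 1"
proof -
  have pow: "X i ^ k = Poly_Mapping.single (Poly_Mapping.single i k) 1" for i :: 'a and k
    by (induction k) (simp_all add: X_def mult_single single_add[symmetric] flip: single_one)
  have "(\<Prod>i\<in>I. X i ^ Poly_Mapping.lookup m i) =
      Poly_Mapping.single (\<Sum>i\<in>I. Poly_Mapping.single i (Poly_Mapping.lookup m i)) 1" for I
    by (induction I rule: infinite_finite_induct) (simp_all add: pow mult_single)
  moreover have "(\<Sum>i\<in>UNIV. Poly_Mapping.single i (Poly_Mapping.lookup m i)) = m"
    by (rule poly_mapping_eqI) (simp add: lookup_sum lookup_single when_def sum.delta' cong: if_cong)
  ultimately show ?thesis
    by (simp add: monomial_value_def)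
qed

lemma substitute_X: "substitute X p = p"
  by (subst (2) F2_poly_eq_sum)
    (simp add: substitute_eq_poly_value poly_value_def monomial_value_X)

section \<open>Homogeneous polynomials\<close>

lemma zero_homogeneous [simp]: "0 \<in> homogeneous_polys d"
  by (simp add: homogeneous_polys_def)

lemma add_homogeneous:
  "p \<in> homogeneous_polys d \<Longrightarrow> q \<in> homogeneous_polys d \<Longrightarrow> p + q \<in> homogeneous_polys d"
  using keys_add[of p q] by (auto simp: homogeneous_polys_def)

lemma sum_homogeneous:
  "(\<And>i. i \<in> I \<Longrightarrow> p i \<in> homogeneous_polys d) \<Longrightarrow> (\<Sum>i\<in>I. p i) \<in> homogeneous_polys d"
  by (induction I rule: infinite_finite_induct) (auto intro: add_homogeneous)

lemma scale_bit_homogeneous: "p \<in> homogeneous_polys d \<Longrightarrow> scale_bit c p \<in> homogeneous_polys d"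
  by (cases c) simp_all

lemma mult_homogeneous:
  assumes "p \<in> homogeneous_polys d" "q \<in> homogeneous_polys e"
  shows "p * q \<in> homogeneous_polys (d + e)"
  unfolding homogeneous_polys_def
proof safe
  fix m assume "m \<in> Poly_Mapping.keys (p * q)"
  then obtain a b where "m = a + b" "a \<in> Poly_Mapping.keys p" "b \<in> Poly_Mapping.keys q"
    using keys_mult[of p q] by blast
  then show "(\<Sum>i\<in>UNIV. Poly_Mapping.lookup m i) = d + e"
    using assms by (simp add: homogeneous_polys_def lookup_add sum.distrib)
qed

lemma one_homogeneous: "1 \<in> homogeneous_polys 0"
  by (simp add: homogeneous_polys_def)

lemma X_homogeneous: "X i \<in> homogeneous_polys 1"
  by (simp add: homogeneous_polys_def X_def lookup_single when_def)

lemma power_homogeneous: "p \<in> homogeneous_polys d \<Longrightarrow> p ^ k \<in> homogeneous_polys (k * d)"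
  by (induction k) (auto simp: one_homogeneous dest: mult_homogeneous)

lemma prod_homogeneous:
  "finite I \<Longrightarrow> (\<And>i. i \<in> I \<Longrightarrow> p i \<in> homogeneous_polys (d i)) \<Longrightarrow>
    (\<Prod>i\<in>I. p i) \<in> homogeneous_polys (\<Sum>i\<in>I. d i)"
  by (induction I rule: finite_induct) (auto simp: one_homogeneous intro: mult_homogeneous)

lemma substitute_homogeneous:
  assumes \<sigma>: "\<And>i. \<sigma> i \<in> homogeneous_polys 1" and p: "p \<in> homogeneous_polys d"
  shows "substitute \<sigma> p \<in> homogeneous_polys d"
  unfolding substitute_eq_poly_value poly_value_def
proof (rule sum_homogeneous)
  fix m assume "m \<in> Poly_Mapping.keys p"
  then have d: "(\<Sum>i\<in>UNIV. Poly_Mapping.lookup m i) = d"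
    using p by (simp add: homogeneous_polys_def)
  show "monomial_value \<sigma> m \<in> homogeneous_polys d"
    unfolding monomial_value_def d[symmetric]
    using power_homogeneous[OF \<sigma>] by (intro prod_homogeneous) simp_all
qed

section \<open>Values at points and the action of invertible matrices\<close>

definition F2_eval :: "'n F2_poly \<Rightarrow> bit ^ 'n \<Rightarrow> bit" where
  "F2_eval p v = poly_value (($) v) (p :: ('n::finite) F2_poly)"

lemma bit_char_2: "(1::bit) + 1 = 0"
  by (rule bit_add_self)

lemmas F2_eval_add = poly_value_add[OF bit_char_2, of "($) v" for v, folded F2_eval_def]
lemmas F2_eval_mult = poly_value_mult[OF bit_char_2, of "($) v" for v, folded F2_eval_def]
lemmas F2_eval_sum = poly_value_sum[OF bit_char_2, of "($) v" for v, folded F2_eval_def]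
lemmas F2_eval_power = poly_value_power[OF bit_char_2, of "($) v" for v, folded F2_eval_def]

lemma F2_eval_simps [simp]:
  "F2_eval (X i) v = v $ i" "F2_eval 0 v = 0" "F2_eval 1 v = 1"
  "F2_eval (scale_bit c p) v = scale_bit c (F2_eval p v)"
  by (simp_all add: F2_eval_def poly_value_scale_bit)

definition dual_action :: "bit ^ 'n ^ 'n \<Rightarrow> ('n::finite) \<Rightarrow> 'n F2_poly" where
  "dual_action A i = (\<Sum>j\<in>UNIV. const_poly (A $ i $ j) * X j)"

lemma GL_poly_action_eq: "GL_poly_action A = substitute (dual_action (matrix_inv A))"
  by (simp add: GL_poly_action_def dual_action_def[abs_def])

lemma dual_action_homogeneous: "dual_action A i \<in> homogeneous_polys 1"
  unfolding dual_action_def const_poly_mult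
  by (intro sum_homogeneous scale_bit_homogeneous X_homogeneous)

lemma scale_bit_mult: "scale_bit c (x::bit) = c * x"
  by (cases c) simp_all

lemma F2_eval_dual_action: "F2_eval (dual_action A i) v = (A *v v) $ i"
  by (simp add: dual_action_def F2_eval_sum const_poly_mult matrix_vector_mult_def scale_bit_mult)

lemma F2_eval_GL_poly_action: "F2_eval (GL_poly_action A p) v = F2_eval p (matrix_inv A *v v)"
  unfolding GL_poly_action_eq F2_eval_def poly_value_substitute[OF bit_char_2]
  by (simp add: F2_eval_dual_action flip: F2_eval_def)

lemma GL_poly_action_add: "GL_poly_action A (p + q) = GL_poly_action A p + GL_poly_action A q"
  by (simp add: GL_poly_action_eq substitute_add)

lemma GL_poly_action_homogeneous:
  "p \<in> homogeneous_polys d \<Longrightarrow> GL_poly_action A p \<in> homogeneous_polys d"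
  unfolding GL_poly_action_eq by (rule substitute_homogeneous[OF dual_action_homogeneous])

lemma scale_bit_sum: "scale_bit c (\<Sum>i\<in>I. f i) = (\<Sum>i\<in>I. scale_bit c (f i))"
  by (cases c) simp_all

text \<open>Substitution reverses the order of the matrices. The inverse in
  \<open>GL_poly_action\<close> reverses it again, which makes that a left action.\<close>

lemma substitute_dual_action:
  "substitute (dual_action A) (dual_action B i) = dual_action (B ** A) i"
proof -
  have "substitute (dual_action A) (dual_action B i) =
      (\<Sum>j\<in>UNIV. scale_bit (B $ i $ j) (dual_action A j))"
    unfolding dual_action_def[of B] const_poly_mult substitute_eq_poly_value
    by (simp add: poly_value_sum[OF F2_poly_add_self] poly_value_scale_bit)
  also have "\<dots> = (\<Sum>j\<in>UNIV. \<Sum>k\<in>UNIV. scale_bit (B $ i $ j * A $ j $ k) (X k))"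
    unfolding dual_action_def const_poly_mult scale_bit_sum
    by (intro sum.cong refl) (simp add: scale_bit_def)
  also have "\<dots> = (\<Sum>k\<in>UNIV. \<Sum>j\<in>UNIV. scale_bit (B $ i $ j * A $ j $ k) (X k))"
    by (rule sum.swap)
  also have "\<dots> = dual_action (B ** A) i"
    unfolding dual_action_def const_poly_mult
  proof (rule sum.cong[OF refl])
    fix k :: 'a
    have "(\<Sum>j\<in>J. scale_bit (c j) (X k)) = scale_bit (\<Sum>j\<in>J. c j) (X k)"
      if "finite J" for J :: "'a set" and c
      using that
    proof (induction J rule: finite_induct)
      case (insert j J)
      then show ?case
        unfolding sum.insert[OF insert.hyps] scale_bit_add_left[OF F2_poly_add_self] insert.IH by simp
    qed simp
    then show "(\<Sum>j\<in>UNIV. scale_bit (B $ i $ j * A $ j $ k) (X k)) =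
        scale_bit ((B ** A) $ i $ k) (X k)"
      by (simp add: matrix_matrix_mult_def)
  qed
  finally show ?thesis .
qed

lemma substitute_dual_action_substitute:
  "substitute (dual_action A) (substitute (dual_action B) p) = substitute (dual_action (B ** A)) p"
  by (simp add: substitute_substitute substitute_dual_action[abs_def])

lemma dual_action_mat_1: "dual_action (mat 1) = X"
proof
  fix i :: 'a
  have "dual_action (mat 1) i = (\<Sum>j\<in>UNIV. if j = i then X j else 0)"
    unfolding dual_action_def const_poly_mult
    by (rule sum.cong) (auto simp: mat_def)
  then show "dual_action (mat 1) i = X i"
    by simp
qed

interpretation F2_poly: module "\<lambda>c (p :: 'n F2_poly). const_poly c * p"
proof
  fix a b and p q :: "'n F2_poly"
  show "const_poly a * (p + q) = const_poly a * p + const_poly a * q"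
    by (rule distrib_left)
  show "const_poly (a + b) * p = const_poly a * p + const_poly b * p"
    by (simp only: const_poly_def single_add distrib_right)
  show "const_poly a * (const_poly b * p) = const_poly (a * b) * p"
    by (simp add: const_poly_def mult_single flip: mult.assoc)
  show "const_poly 1 * p = p"
    by (simp add: const_poly_def)
qed

section \<open>Cubic forms that vanish at every point\<close>

lemma S3_relations_subset:
  "S3_relations \<subseteq> {p. p \<in> homogeneous_polys 3 \<and> (\<forall>v. F2_eval p v = 0)}"
proof
  fix p :: "('n::finite) F2_poly"
  assume "p \<in> S3_relations"
  then show "p \<in> {p. p \<in> homogeneous_polys 3 \<and> (\<forall>v. F2_eval p v = 0)}"
    unfolding S3_relations_def
  proof (induction rule: F2_poly.span_induct_alt)
    case base
    show ?case by simp
  next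
    case (step c r q)
    then obtain i j :: 'n where r: "r = X i ^ 2 * X j + X i * X j ^ 2" by blast
    have "X i ^ 2 * X j \<in> homogeneous_polys (2 * 1 + 1)" "X i * X j ^ 2 \<in> homogeneous_polys (1 + 2 * 1)"
      by (intro mult_homogeneous power_homogeneous X_homogeneous)+
    then have "r \<in> homogeneous_polys 3"
      unfolding r by (intro add_homogeneous) (simp_all add: numeral_3_eq_3)
    moreover have "F2_eval r v = 0" for v
      unfolding r F2_eval_add F2_eval_mult F2_eval_power F2_eval_simps
      by (cases "v $ i"; cases "v $ j"; simp)
    ultimately show ?case
      using step by (auto simp: const_poly_mult F2_eval_add intro: add_homogeneous scale_bit_homogeneous)
  qed
qed

lemma of_nat_bit: "(of_nat n :: bit) = of_bool (odd n)"
  by (induction n) simp_all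

text \<open>At the indicator vector of \<open>T\<close> a monomial has value 1 exactly when its
  support lies in \<open>T\<close>, so \<open>p\<close> counts these monomials modulo 2. Removing
  the contributions of the proper subsets of \<open>T\<close>, even by induction, leaves those with
  support exactly \<open>T\<close>.\<close>

lemma even_card_support:
  assumes "\<And>v. F2_eval p v = 0"
  shows "even (card {m \<in> Poly_Mapping.keys p. Poly_Mapping.keys m = T})"
proof (induction T rule: measure_induct_rule[of card])
  case (less T)
  let ?K = "\<lambda>T. {m \<in> Poly_Mapping.keys p. Poly_Mapping.keys m = T}"
  have mon: "monomial_value (($) (\<chi> i. if i \<in> T then 1 else 0)) m =
      (if Poly_Mapping.keys m \<subseteq> T then 1 else (0::bit))" for m
  proof (cases "Poly_Mapping.keys m \<subseteq> T")
    case True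
    then have "i \<notin> T \<Longrightarrow> Poly_Mapping.lookup m i = 0" for i
      by (auto simp: in_keys_iff)
    then show ?thesis
      using True unfolding monomial_value_def by (auto intro!: prod.neutral)
  next
    case False
    then obtain i where "i \<notin> T" "Poly_Mapping.lookup m i \<noteq> 0"
      by (auto simp: in_keys_iff)
    then show ?thesis
      using False unfolding monomial_value_def by (auto intro!: prod_zero bexI[of _ i])
  qed
  have "0 = (\<Sum>m\<in>Poly_Mapping.keys p. if Poly_Mapping.keys m \<subseteq> T then 1 else (0::bit))"
    using assms[of "\<chi> i. if i \<in> T then 1 else 0"] by (simp add: F2_eval_def poly_value_def mon)
  also have "\<dots> = of_nat (card {m \<in> Poly_Mapping.keys p. Poly_Mapping.keys m \<subseteq> T})"
    by (simp add: sum.If_cases Int_def)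
  finally have even: "even (card {m \<in> Poly_Mapping.keys p. Poly_Mapping.keys m \<subseteq> T})"
    by (simp add: of_nat_bit)
  have "{m \<in> Poly_Mapping.keys p. Poly_Mapping.keys m \<subseteq> T} = ?K T \<union> (\<Union>S\<in>{S. S \<subset> T}. ?K S)"
    by auto
  also have "card \<dots> = card (?K T) + card (\<Union>S\<in>{S. S \<subset> T}. ?K S)"
    by (rule card_Un_disjoint) auto
  also have "card (\<Union>S\<in>{S. S \<subset> T}. ?K S) = (\<Sum>S\<in>{S. S \<subset> T}. card (?K S))"
    by (rule card_UN_disjoint) auto
  finally have "card {m \<in> Poly_Mapping.keys p. Poly_Mapping.keys m \<subseteq> T} =
    card (?K T) + (\<Sum>S\<in>{S. S \<subset> T}. card (?K S))" .
  moreover have "even (\<Sum>S\<in>{S. S \<subset> T}. card (?K S))"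
    using less by (intro dvd_sum) (auto simp: psubset_card_mono)
  ultimately show ?case
    using even by auto
qed

text \<open>Exponents are positive on the support and sum to 3. A support of size 1 forces the
  exponent 3 and one of size 3 forces 1, 1, 1; only size 2 leaves a choice, between 2, 1 and 1,
  2.\<close>

lemma same_support_cubic:
  fixes m m' :: "('n::finite) \<Rightarrow>\<^sub>0 nat"
  assumes deg: "(\<Sum>i\<in>UNIV. Poly_Mapping.lookup m i) = 3" "(\<Sum>i\<in>UNIV. Poly_Mapping.lookup m' i) = 3"
    and supp: "Poly_Mapping.keys m = Poly_Mapping.keys m'" and neq: "m \<noteq> m'"
  obtains a b where "a \<noteq> b"
    "m = Poly_Mapping.single a 2 + Poly_Mapping.single b 1"
    "m' = Poly_Mapping.single a 1 + Poly_Mapping.single b 2"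
proof -
  let ?T = "Poly_Mapping.keys m"
  have sums: "(\<Sum>i\<in>?T. Poly_Mapping.lookup m i) = 3" "(\<Sum>i\<in>?T. Poly_Mapping.lookup m' i) = 3"
  proof -
    have "(\<Sum>i\<in>Poly_Mapping.keys n. Poly_Mapping.lookup n i) = (\<Sum>i\<in>UNIV. Poly_Mapping.lookup n i)"
      for n :: "'n \<Rightarrow>\<^sub>0 nat"
      by (rule sum.mono_neutral_left) (auto simp: in_keys_iff)
    from this[of m] this[of m'] show "(\<Sum>i\<in>?T. Poly_Mapping.lookup m i) = 3"
        "(\<Sum>i\<in>?T. Poly_Mapping.lookup m' i) = 3"
      by (simp_all add: deg flip: supp)
  qed
  have pos: "Poly_Mapping.lookup m i > 0" "Poly_Mapping.lookup m' i > 0" if "i \<in> ?T" for i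
    using that supp by (auto simp: in_keys_iff)
  have out: "Poly_Mapping.lookup m i = 0" "Poly_Mapping.lookup m' i = 0" if "i \<notin> ?T" for i
    using that supp by (auto simp: in_keys_iff)
  have "card ?T \<le> 3"
    using sum_mono[of ?T "\<lambda>_. 1" "Poly_Mapping.lookup m"] pos sums by (simp add: Suc_leI)
  moreover have "card ?T \<noteq> 0"
    using sums by (intro notI) (simp add: card_eq_0_iff)
  ultimately consider "card ?T = 1" | "card ?T = 2" | "card ?T = 3" by linarith
  then show thesis
  proof cases
    case 1
    then obtain a where a: "?T = {a}" by (auto simp: card_1_singleton_iff)
    have "m = m'"
    proof (rule poly_mapping_eqI)
      fix i
      show "Poly_Mapping.lookup m i = Poly_Mapping.lookup m' i"
        using sums out[of i] unfolding a by (cases "i = a") auto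
    qed
    with neq show thesis ..
  next
    case 2
    then obtain a b where ab: "?T = {a, b}" "a \<noteq> b" by (auto simp: card_2_iff)
    have sum: "Poly_Mapping.lookup m a + Poly_Mapping.lookup m b = 3"
        "Poly_Mapping.lookup m' a + Poly_Mapping.lookup m' b = 3"
      using sums ab by simp_all
    have gt: "Poly_Mapping.lookup m a > 0" "Poly_Mapping.lookup m b > 0"
        "Poly_Mapping.lookup m' a > 0" "Poly_Mapping.lookup m' b > 0"
      using pos ab by simp_all
    have ne: "Poly_Mapping.lookup m a \<noteq> Poly_Mapping.lookup m' a"
    proof
      assume "Poly_Mapping.lookup m a = Poly_Mapping.lookup m' a"
      then have "Poly_Mapping.lookup m i = Poly_Mapping.lookup m' i" for i
        using sum out[of i] ab by (cases "i = a"; cases "i = b") auto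
      with neq show False by (simp add: poly_mapping_eq_iff fun_eq_iff)
    qed
    have eqI: "n = Poly_Mapping.single c j + Poly_Mapping.single d k"
      if "c \<noteq> d" "Poly_Mapping.lookup n c = j" "Poly_Mapping.lookup n d = k"
        "\<And>i. i \<noteq> c \<Longrightarrow> i \<noteq> d \<Longrightarrow> Poly_Mapping.lookup n i = 0" for n :: "'n \<Rightarrow>\<^sub>0 nat" and c d j k
      using that by (intro poly_mapping_eqI) (auto simp: lookup_add lookup_single when_def)
    have out': "Poly_Mapping.lookup m i = 0" "Poly_Mapping.lookup m' i = 0" if "i \<noteq> a" "i \<noteq> b" for i
      using out[of i] that ab by auto
    consider "Poly_Mapping.lookup m a = 2" "Poly_Mapping.lookup m b = 1"
        "Poly_Mapping.lookup m' a = 1" "Poly_Mapping.lookup m' b = 2"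
      | "Poly_Mapping.lookup m a = 1" "Poly_Mapping.lookup m b = 2"
        "Poly_Mapping.lookup m' a = 2" "Poly_Mapping.lookup m' b = 1"
      using sum gt ne by linarith
    then show thesis
    proof cases
      case 1
      then show thesis
        using ab(2) out' by (intro that[of a b] eqI) auto
    next
      case 2
      then show thesis
        using ab(2) out' by (intro that[of b a] eqI) auto
    qed
  next
    case 3
    have one: "Poly_Mapping.lookup n i = 1"
      if "(\<Sum>i\<in>?T. Poly_Mapping.lookup n i) = 3" "\<And>i. i \<in> ?T \<Longrightarrow> Poly_Mapping.lookup n i > 0" "i \<in> ?T"
      for n :: "'n \<Rightarrow>\<^sub>0 nat" and i
    proof -
      have "(\<Sum>i\<in>?T - {i}. 1) \<le> (\<Sum>i\<in>?T - {i}. Poly_Mapping.lookup n i)"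
        using that(2) by (intro sum_mono) (simp add: Suc_leI)
      moreover have "(\<Sum>i\<in>?T. Poly_Mapping.lookup n i) =
          Poly_Mapping.lookup n i + (\<Sum>i\<in>?T - {i}. Poly_Mapping.lookup n i)"
        using that(3) by (intro sum.remove) auto
      ultimately show ?thesis
        using that(2)[OF that(3)] that(1,3) 3 by simp
    qed
    have "m = m'"
      using one[OF sums(1) pos(1)] one[OF sums(2) pos(2)] out
      by (intro poly_mapping_eqI) metis
    with neq show thesis ..
  qed
qed

text \<open>Induction on the number of monomials. By parity each monomial of \<open>p\<close> has a
  different partner with the same support; the two together form a relation \<open>r\<close>, and
  adding \<open>r\<close> removes both.\<close>

lemma in_S3_relations:
  assumes "p \<in> homogeneous_polys 3" "\<And>v. F2_eval p v = 0"
  shows "p \<in> S3_relations"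
  using assms
proof (induction p rule: measure_induct_rule[of "\<lambda>p. card (Poly_Mapping.keys p)"])
  case (less p)
  show ?case
  proof (cases "p = 0")
    case True
    then show ?thesis
      using F2_poly.span_zero by (simp add: S3_relations_def)
  next
    case False
    then obtain m where m: "m \<in> Poly_Mapping.keys p" by fastforce
    let ?K = "{n \<in> Poly_Mapping.keys p. Poly_Mapping.keys n = Poly_Mapping.keys m}"
    have "even (card ?K)"
      by (rule even_card_support) (rule less.prems)
    then have "?K \<noteq> {m}"
      by (metis card_1_singleton_iff odd_one One_nat_def)
    moreover have "m \<in> ?K" using m by simp
    ultimately obtain m' where m': "m' \<in> Poly_Mapping.keys p"
        "Poly_Mapping.keys m = Poly_Mapping.keys m'" "m \<noteq> m'"
      by blast
    obtain a b where ab: "a \<noteq> b"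
        "m = Poly_Mapping.single a 2 + Poly_Mapping.single b 1"
        "m' = Poly_Mapping.single a 1 + Poly_Mapping.single b 2"
    proof (rule same_support_cubic[of m m'])
      show "(\<Sum>i\<in>UNIV. Poly_Mapping.lookup m i) = 3" "(\<Sum>i\<in>UNIV. Poly_Mapping.lookup m' i) = 3"
        using less.prems(1) m m' by (auto simp: homogeneous_polys_def)
    qed (use m' in auto)
    define r :: "'a F2_poly" where "r = X a ^ 2 * X b + X a * X b ^ 2"
    have "r \<in> S3_relations"
      unfolding S3_relations_def r_def by (rule F2_poly.span_base) blast
    then have r: "r \<in> homogeneous_polys 3" "F2_eval r v = 0" for v
      using S3_relations_subset by blast+
    have r_eq: "r = Poly_Mapping.single m 1 + Poly_Mapping.single m' 1"
      by (simp add: r_def X_def ab numeral_2_eq_2 mult_single flip: single_add)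
    have "Poly_Mapping.keys (p + r) \<subseteq> Poly_Mapping.keys p - {m, m'}"
      using m m' by (auto simp: r_eq in_keys_iff lookup_add lookup_single when_def bit_add_self
          split: if_splits)
    then have "card (Poly_Mapping.keys (p + r)) < card (Poly_Mapping.keys p)"
      using m by (intro psubset_card_mono) auto
    then have "p + r \<in> S3_relations"
      using less.prems r by (intro less.IH) (auto simp: F2_eval_add intro: add_homogeneous)
    then have "(p + r) + r \<in> S3_relations"
      using \<open>r \<in> S3_relations\<close> F2_poly.span_add unfolding S3_relations_def by blast
    then show ?thesis
      by (simp only: add.assoc F2_poly_add_self add_0_right)
  qed
qed

lemma S3_relations_eq:
  "S3_relations = {p \<in> homogeneous_polys 3. \<forall>v. F2_eval p v = 0}"
  using S3_relations_subset in_S3_relations by blast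

section \<open>The diagonal of a 3-cocycle\<close>

definition coord_proj :: "'n set \<Rightarrow> bit ^ 'n \<Rightarrow> bit ^ 'n" where
  "coord_proj S v = (\<chi> j. if j \<in> S then v $ j else 0)"

lemma coord_proj_add: "coord_proj S (u + v) = coord_proj S u + coord_proj S v"
  by (simp add: coord_proj_def vec_eq_iff)

lemma coord_proj_0 [simp]: "coord_proj S 0 = 0"
  by (simp add: coord_proj_def vec_eq_iff)

lemma coord_proj_empty [simp]: "coord_proj {} v = 0"
  by (simp add: coord_proj_def vec_eq_iff)

lemma coord_proj_UNIV [simp]: "coord_proj UNIV v = v"
  by (simp add: coord_proj_def vec_eq_iff)

lemma coord_proj_nth: "i \<notin> S \<Longrightarrow> coord_proj S v $ i = 0"
  by (simp add: coord_proj_def)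

lemma coord_proj_coord_proj: "S \<subseteq> T \<Longrightarrow> coord_proj T (coord_proj S v) = coord_proj S v"
  by (auto simp: coord_proj_def vec_eq_iff)

lemma coord_proj_axis: "i \<notin> S \<Longrightarrow> coord_proj S (axis i 1) = 0"
  by (auto simp: coord_proj_def axis_def vec_eq_iff)

lemma coord_proj_insert:
  "i \<notin> S \<Longrightarrow> coord_proj (insert i S) v = coord_proj S v + scale_bit (v $ i) (axis i 1)"
  by (auto simp: coord_proj_def axis_def scale_bit_def vec_eq_iff)

lemma bit_vec_add_self: "(v :: bit ^ 'n) + v = 0"
  by (simp only: vec_eq_iff vector_add_component bit_add_self zero_index simp_thms)

text \<open>In the application \<open>w\<close> is -1 in additive notation. The condition sees only
  the values of \<open>p\<close>, so \<open>p\<close> is determined up to forms vanishing at every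
  point.\<close>

definition represented :: "nat \<Rightarrow> 'a::zero \<Rightarrow> (bit ^ 'n \<Rightarrow> 'a) \<Rightarrow> bool" where
  "represented d w F \<longleftrightarrow>
     (\<exists>p \<in> homogeneous_polys d. \<forall>v. F v = scale_bit (F2_eval (p :: ('n::finite) F2_poly) v) w)"

text \<open>For \<open>v + v = 0\<close> this is the class of the restriction of \<open>f\<close> to the cyclic group generated by
  \<open>v\<close>; the term \<open>f v 0 v\<close> makes it vanish also on coboundaries of cochains that are not
  normalized.\<close>

definition diagonal :: "('v::zero \<Rightarrow> 'v \<Rightarrow> 'v \<Rightarrow> 'a::plus) \<Rightarrow> 'v \<Rightarrow> 'a" where
  "diagonal f v = f v 0 v + f v v v"

lemma diagonal_cob2:
  assumes "v + v = 0"
  shows "diagonal (cob2 g) v = 0"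
  using assms by (simp add: diagonal_def cob2_def)

section \<open>Cocycles of degree 1 and 2 with coefficients whose 2-torsion is {0, w}\<close>

context
  fixes w :: "'a::ab_group_add"
  assumes w: "w + w = 0" and torsion: "\<And>a :: 'a. a + a = 0 \<Longrightarrow> a = 0 \<or> a = w"
begin

lemma represented_0: "represented d w (\<lambda>v. 0)"
  unfolding represented_def by (rule bexI[of _ 0]) simp_all

lemma represented_add:
  assumes "represented d w F" "represented d w G"
  shows "represented d w (\<lambda>v. F v + G v)"
proof -
  obtain p q where "p \<in> homogeneous_polys d" "q \<in> homogeneous_polys d"
      "\<And>v. F v = scale_bit (F2_eval p v) w" "\<And>v. G v = scale_bit (F2_eval q v) w"
    using assms by (auto simp: represented_def)
  then show ?thesis
    unfolding represented_def
    by (intro bexI[of _ "p + q"] add_homogeneous allI)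
      (simp_all only: F2_eval_add scale_bit_add_left[OF w])
qed

lemma represented_coord_mult:
  assumes "represented d w F"
  shows "represented (d + 1) w (\<lambda>v. scale_bit (v $ i) (F v))"
proof -
  obtain p where "p \<in> homogeneous_polys d" "\<And>v. F v = scale_bit (F2_eval p v) w"
    using assms by (auto simp: represented_def)
  then show ?thesis
    unfolding represented_def
    by (intro bexI[of _ "p * X i"] mult_homogeneous X_homogeneous allI)
      (simp_all add: F2_eval_mult scale_bit_def)
qed

text \<open>Over F_2 the form x_i^d has the same values as x_i for d > 0, so a coordinate function
  is available in the degree that each induction asks for.\<close>

lemma represented_coord:
  assumes "s + s = 0" "d > 0"
  shows "represented d w (\<lambda>v. scale_bit (v $ i) s)"
proof -
  obtain c where c: "s = scale_bit c w"
    using torsion[OF assms(1)] by (metis scale_bit_simps(1,2))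
  have "X i ^ d \<in> homogeneous_polys d"
    using power_homogeneous[OF X_homogeneous, of i d] by simp
  moreover have pow: "x ^ d = x" for x :: bit
    using assms(2) by (cases x) simp_all
  have "scale_bit (v $ i) (scale_bit c w) = scale_bit (F2_eval (scale_bit c (X i ^ d)) v) w" for v
    unfolding F2_eval_simps F2_eval_power pow by (cases c) simp_all
  ultimately show ?thesis
    unfolding represented_def c
    by (intro bexI[of _ "scale_bit c (X i ^ d)"] scale_bit_homogeneous allI)
qed

lemma additive_represented:
  assumes l: "\<And>u v. l (u + v) = l u + l v" "\<And>v. l v + l v = (0::'a)" and S: "finite S"
  shows "represented 1 w (\<lambda>v. l (coord_proj S v))"
  using S
proof (induction S rule: finite_induct)
  case empty
  have "l 0 = 0" using l(1)[of 0 0] by simp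
  then show ?case using represented_0 by simp
next
  case (insert i S)
  have "l 0 = 0" using l(1)[of 0 0] by simp
  then have "l (coord_proj (insert i S) v) = l (coord_proj S v) + scale_bit (v $ i) (l (axis i 1))" for v
    unfolding coord_proj_insert[OF insert.hyps(2)] l(1) by (cases "v $ i") simp_all
  then show ?case
    using represented_add[OF insert.IH represented_coord[OF l(2), of 1 i "axis i 1"]] by simp
qed

text \<open>The two conditions on \<open>c\<close> make its coboundary invisible on the diagonal:
  \<open>cob1 c v v = c v - c 0 + c v\<close>, which is 0.\<close>

lemma split_2_coord:
  assumes q: "\<And>u v w. cob2 q u v w = 0" "normalized2 q" "\<And>u v. q u v + q u v = (0::'a)"
    and i: "i \<notin> S"
  obtains l s c where "\<And>a b. l (a + b) = l a + l b" "\<And>a. l a + l a = 0" "s + s = 0"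
    "\<And>u. c u + c u = 0" "c 0 = 0"
    "\<And>u v. q (coord_proj (insert i S) u) (coord_proj (insert i S) v) =
       q (coord_proj S u) (coord_proj S v) + scale_bit (v $ i) (l (coord_proj S u))
       + scale_bit (u $ i * v $ i) s + cob1 c u v"
proof -
  obtain l s c where *: "\<And>a b. l (a + b) = l a + l b" "\<And>a. l a + l a = 0" "s + s = 0"
    "\<And>u. c u + c u = 0"
    "\<And>u v. q (coord_proj S u + scale_bit (u $ i) (axis i 1)) (coord_proj S v + scale_bit (v $ i) (axis i 1)) =
       q (coord_proj S u) (coord_proj S v) + scale_bit (v $ i) (l (coord_proj S u))
       + scale_bit (u $ i * v $ i) s + cob1 c u v"
    by (rule split_2_cocycle[OF q, of "axis i 1" "coord_proj S" "\<lambda>v. v $ i"])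
      (auto simp: bit_vec_add_self coord_proj_add)
  have "c 0 = 0"
    using *(5)[of 0 0] by (simp add: cob1_def)
  show thesis
    by (rule that[of l s c, OF *(1-4) \<open>c 0 = 0\<close>])
      (simp only: coord_proj_insert[OF i] *(5))
qed

text \<open>Restricted to the diagonal, the splitting adds x_i times a linear form and s x_i^2 to a
  quadratic form in the earlier coordinates.\<close>

lemma cocycle_2_represented:
  assumes q: "\<And>u v w. cob2 q u v w = 0" "normalized2 q" "\<And>u v. q u v + q u v = (0::'a)"
    and S: "finite S"
  shows "represented 2 w (\<lambda>v. q (coord_proj S v) (coord_proj S v))"
  using S
proof (induction S rule: finite_induct)
  case empty
  show ?case using q(2) represented_0 by (simp add: normalized2_def)
next
  case (insert i S)
  from insert.hyps(2) obtain l s c where l: "\<And>a b. l (a + b) = l a + l b" "\<And>a. l a + l a = 0"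
    and s: "s + s = 0" and c: "\<And>u. c u + c u = 0" "c 0 = 0"
    and *: "\<And>u v. q (coord_proj (insert i S) u) (coord_proj (insert i S) v) =
       q (coord_proj S u) (coord_proj S v) + scale_bit (v $ i) (l (coord_proj S u))
       + scale_bit (u $ i * v $ i) s + cob1 c u v"
    using split_2_coord[OF q] by blast
  have "q (coord_proj (insert i S) v) (coord_proj (insert i S) v) =
      q (coord_proj S v) (coord_proj S v) + scale_bit (v $ i) (l (coord_proj S v))
      + scale_bit (v $ i) s" for v
    unfolding * by (simp add: cob1_def bit_vec_add_self c)
  moreover have "represented 2 w (\<lambda>v. scale_bit (v $ i) (l (coord_proj S v)))"
    using represented_coord_mult[OF additive_represented[OF l insert.hyps(1)]]
    by (simp add: numeral_2_eq_2)
  ultimately show ?case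
    using insert.IH represented_coord[OF s, of 2 i] by (simp add: represented_add)
qed

text \<open>The primitive \<open>c\<close> is required to be 2-torsion because degree 3 multiplies
  it by a coordinate, and \<open>scale_bit\<close> respects addition of bits only then.\<close>

lemma cocycle_2_trivial:
  assumes q: "\<And>u v w. cob2 q u v w = 0" "normalized2 q" "\<And>u v. q u v + q u v = (0::'a)"
    and S: "finite S" and diag: "\<And>v. q (coord_proj S v) (coord_proj S v) = 0"
  shows "\<exists>c. (\<forall>u. c u + c u = 0) \<and> (\<forall>u v. q (coord_proj S u) (coord_proj S v) = cob1 c u v)"
  using S diag
proof (induction S rule: finite_induct)
  case empty
  show ?case
    using q(2) by (intro exI[of _ "\<lambda>_. 0"]) (simp add: normalized2_def cob1_def)
next
  case (insert i S)
  from insert.hyps(2) obtain l s c where l: "\<And>a b. l (a + b) = l a + l b" "\<And>a. l a + l a = 0"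
    and s: "s + s = 0" and c: "\<And>u. c u + c u = 0" "c 0 = 0"
    and *: "\<And>u v. q (coord_proj (insert i S) u) (coord_proj (insert i S) v) =
       q (coord_proj S u) (coord_proj S v) + scale_bit (v $ i) (l (coord_proj S u))
       + scale_bit (u $ i * v $ i) s + cob1 c u v"
    using split_2_coord[OF q] by blast
  have cob: "cob1 c v v = 0" for v
    by (simp add: cob1_def bit_vec_add_self c)
  have diag: "q (coord_proj S v) (coord_proj S v) = 0" for v
    using insert.prems[of "coord_proj S v"] by (simp add: coord_proj_coord_proj subset_insertI)
  have l0: "l 0 = 0" using l(1)[of 0 0] by simp
  have t: "coord_proj S (coord_proj S v + axis i 1) = coord_proj S v"
      "(coord_proj S v + axis i 1) $ i = 1" for v
    using insert.hyps(2)
    by (simp_all add: coord_proj_add coord_proj_coord_proj coord_proj_axis coord_proj_nth)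
  \<comment> \<open>Adding the i-th basis vector makes the i-th coordinate 1 without changing the
    projection to \<open>S\<close>. The sum \<open>l + s\<close> then vanishes everywhere; at 0 it
    gives \<open>s = 0\<close>, and so \<open>l\<close> vanishes too.\<close>
  have ls: "l (coord_proj S v) + s = 0" for v
    using *[of "coord_proj S v + axis i 1" "coord_proj S v + axis i 1"]
    unfolding insert.prems cob t by (simp add: diag)
  then have "s = 0"
    using ls[of 0] l0 by simp
  with ls have "q (coord_proj (insert i S) u) (coord_proj (insert i S) v) =
      q (coord_proj S u) (coord_proj S v) + cob1 c u v" for u v
    unfolding * by simp
  moreover obtain c' where c': "\<And>u. c' u + c' u = 0"
      "\<And>u v. q (coord_proj S u) (coord_proj S v) = cob1 c' u v"
    using insert.IH[OF diag] by blast
  ultimately have cob': "q (coord_proj (insert i S) u) (coord_proj (insert i S) v) =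
      cob1 (\<lambda>u. c' u + c u) u v" for u v
    by (simp add: cob1_def algebra_simps)
  have two: "(c' u + c u) + (c' u + c u) = 0" for u
  proof -
    have "(c' u + c u) + (c' u + c u) = (c' u + c' u) + (c u + c u)"
      by (simp only: ac_simps)
    then show ?thesis by (simp add: c c')
  qed
  show ?case
    using two cob' by (intro exI[of _ "\<lambda>u. c' u + c u"] conjI allI)
qed

section \<open>Cocycles of degree 3 with coefficients divisible by 2\<close>

context
  assumes divisible: "\<And>a :: 'a. \<exists>b. b + b = a"
begin

lemma split_3_coord:
  assumes f: "\<And>u v w z. cob3 f u v w z = (0::'a)" "normalized3 f" and i: "i \<notin> S"
  obtains q s g where "\<And>u v w. cob2 q u v w = 0" "normalized2 q" "\<And>u v. q u v + q u v = 0"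
    "s + s = 0" "\<And>v. cob2 g v v v = 0"
    "\<And>u v w. f (coord_proj (insert i S) u) (coord_proj (insert i S) v) (coord_proj (insert i S) w) =
       f (coord_proj S u) (coord_proj S v) (coord_proj S w)
       + scale_bit (w $ i) (q (coord_proj S u) (coord_proj S v))
       + scale_bit (u $ i * v $ i * w $ i) s + cob2 g u v w"
proof -
  obtain q s g where *: "\<And>u v w. cob2 q u v w = 0" "normalized2 q" "\<And>u v. q u v + q u v = 0"
    "s + s = 0"
    "\<And>u v w. f (coord_proj S u + scale_bit (u $ i) (axis i 1)) (coord_proj S v + scale_bit (v $ i) (axis i 1))
         (coord_proj S w + scale_bit (w $ i) (axis i 1)) =
       f (coord_proj S u) (coord_proj S v) (coord_proj S w)
       + scale_bit (w $ i) (q (coord_proj S u) (coord_proj S v))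
       + scale_bit (u $ i * v $ i * w $ i) s + cob2 g u v w"
    by (rule split_3_cocycle[OF f divisible, of "axis i 1" "coord_proj S" "\<lambda>v. v $ i"])
      (auto simp: bit_vec_add_self coord_proj_add)
  \<comment> \<open>At \<open>(v, 0, v)\<close> normalization kills every other term of the
    splitting. As \<open>v + v = 0\<close>, the values of \<open>cob2 g\<close> at
    \<open>(v, v, v)\<close> and \<open>(v, 0, v)\<close> differ only in sign, so the diagonal does
    not see \<open>g\<close>.\<close>
  have "cob2 g v 0 v = 0" for v
    using *(5)[of v 0 v] f(2) *(2) by (simp add: normalized3_def normalized2_def)
  then have "cob2 g v v v = 0" for v
    by (simp add: cob2_def bit_vec_add_self)
  then show thesis
    by (rule that[of q s g, OF *(1-4)])
      (simp only: coord_proj_insert[OF i] *(5))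
qed

lemma cocycle_3_represented:
  assumes f: "\<And>u v w z. cob3 f u v w z = (0::'a)" "normalized3 f" and S: "finite S"
  shows "represented 3 w (\<lambda>v. f (coord_proj S v) (coord_proj S v) (coord_proj S v))"
  using S
proof (induction S rule: finite_induct)
  case empty
  show ?case using f(2) represented_0 by (simp add: normalized3_def)
next
  case (insert i S)
  from insert.hyps(2) obtain q s g where q: "\<And>u v w. cob2 q u v w = 0" "normalized2 q"
      "\<And>u v. q u v + q u v = 0"
    and s: "s + s = 0" and g: "\<And>v. cob2 g v v v = 0"
    and *: "\<And>u v w. f (coord_proj (insert i S) u) (coord_proj (insert i S) v) (coord_proj (insert i S) w) =
       f (coord_proj S u) (coord_proj S v) (coord_proj S w)
       + scale_bit (w $ i) (q (coord_proj S u) (coord_proj S v))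
       + scale_bit (u $ i * v $ i * w $ i) s + cob2 g u v w"
    using split_3_coord[OF f] by blast
  have "f (coord_proj (insert i S) v) (coord_proj (insert i S) v) (coord_proj (insert i S) v) =
      f (coord_proj S v) (coord_proj S v) (coord_proj S v)
      + scale_bit (v $ i) (q (coord_proj S v) (coord_proj S v)) + scale_bit (v $ i) s" for v
    unfolding * g by (cases "v $ i") simp_all
  moreover have "represented 3 w (\<lambda>v. scale_bit (v $ i) (q (coord_proj S v) (coord_proj S v)))"
    using represented_coord_mult[OF cocycle_2_represented[OF q insert.hyps(1)]]
    by (simp add: numeral_3_eq_3 numeral_2_eq_2)
  ultimately show ?case
    using insert.IH represented_coord[OF s, of 3 i] by (simp add: represented_add)
qed

text \<open>Vectors with i-th coordinate 0 show that the diagonal over \<open>S\<close> vanishes;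
  vectors with i-th coordinate 1 then give \<open>s = 0\<close> and a vanishing diagonal of
  \<open>q\<close>, to which the degree 2 result applies.\<close>

lemma cocycle_3_trivial:
  assumes f: "\<And>u v w z. cob3 f u v w z = (0::'a)" "normalized3 f" and S: "finite S"
    and diag: "\<And>v. f (coord_proj S v) (coord_proj S v) (coord_proj S v) = 0"
  shows "\<exists>g. \<forall>u v w. f (coord_proj S u) (coord_proj S v) (coord_proj S w) = cob2 g u v w"
  using S diag
proof (induction S rule: finite_induct)
  case empty
  show ?case
    using f(2) by (intro exI[of _ "\<lambda>_ _. 0"]) (simp add: normalized3_def cob2_def)
next
  case (insert i S)
  from insert.hyps(2) obtain q s g where q: "\<And>u v w. cob2 q u v w = 0" "normalized2 q"
      "\<And>u v. q u v + q u v = 0"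
    and s: "s + s = 0" and g: "\<And>v. cob2 g v v v = 0"
    and *: "\<And>u v w. f (coord_proj (insert i S) u) (coord_proj (insert i S) v) (coord_proj (insert i S) w) =
       f (coord_proj S u) (coord_proj S v) (coord_proj S w)
       + scale_bit (w $ i) (q (coord_proj S u) (coord_proj S v))
       + scale_bit (u $ i * v $ i * w $ i) s + cob2 g u v w"
    using split_3_coord[OF f] by blast
  have diag: "f (coord_proj S v) (coord_proj S v) (coord_proj S v) = 0" for v
    using insert.prems[of "coord_proj S v"] by (simp add: coord_proj_coord_proj subset_insertI)
  have t: "coord_proj S (coord_proj S v + axis i 1) = coord_proj S v"
      "(coord_proj S v + axis i 1) $ i = 1" for v
    using insert.hyps(2)
    by (simp_all add: coord_proj_add coord_proj_coord_proj coord_proj_axis coord_proj_nth)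
  have qs: "q (coord_proj S v) (coord_proj S v) + s = 0" for v
    using *[of "coord_proj S v + axis i 1" "coord_proj S v + axis i 1" "coord_proj S v + axis i 1"]
    unfolding insert.prems g t by (simp add: diag)
  then have "s = 0"
    using qs[of 0] q(2) by (simp add: normalized2_def)
  with qs have "q (coord_proj S v) (coord_proj S v) = 0" for v
    by simp
  then obtain c where c: "\<And>u. c u + c u = 0"
      "\<And>u v. q (coord_proj S u) (coord_proj S v) = cob1 c u v"
    using cocycle_2_trivial[OF q insert.hyps(1)] by blast
  \<comment> \<open>The product of \<open>c\<close> with the coordinate is a primitive of the
    product of \<open>cob1 c\<close> with it; the carry term \<open>c u + c u\<close> vanishes by
    2-torsion.\<close>
  have cup: "scale_bit (w $ i) (cob1 c u v) = cob2 (\<lambda>u v. scale_bit (v $ i) (c u)) u v w" for u v w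
    using c(1)[of u] by (cases "v $ i"; cases "w $ i"; simp add: cob2_def cob1_def algebra_simps)
  obtain g' where g': "\<And>u v w. f (coord_proj S u) (coord_proj S v) (coord_proj S w) = cob2 g' u v w"
    using insert.IH[OF diag] by blast
  have "f (coord_proj (insert i S) u) (coord_proj (insert i S) v) (coord_proj (insert i S) w) =
      cob2 (\<lambda>u v. g' u v + scale_bit (v $ i) (c u) + g u v) u v w" for u v w
    unfolding * g' c(2) cup \<open>s = 0\<close> by (simp add: cob2_def algebra_simps)
  then show ?case
    by blast
qed

text \<open>The diagonal does not change under the normalizing coboundary, and for a normalized
  cocycle it is simply \<open>f v v v\<close>; this carries the inductions over to all
  cocycles.\<close>

lemma normalized_representative:
  fixes f :: "bit ^ 'n \<Rightarrow> bit ^ 'n \<Rightarrow> bit ^ 'n \<Rightarrow> 'a"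
  assumes f: "\<And>u v w z. cob3 f u v w z = 0"
  obtains f' g where "\<And>u v w z. cob3 f' u v w z = 0" "normalized3 f'"
    "\<And>v. f' v v v = diagonal f v" "\<And>u v w. f' u v w = f u v w + cob2 g u v w"
proof -
  obtain g where n: "normalized3 (\<lambda>u v w. f u v w + cob2 g u v w)"
    using normalize_3_cocycle[OF f] by blast
  define f' where "f' u v w = f u v w + cob2 g u v w" for u v w
  have "cob3 f' u v w z = cob3 f u v w z + cob3 (cob2 g) u v w z" for u v w z
    by (simp add: f'_def cob3_def algebra_simps)
  then have "cob3 f' u v w z = 0" for u v w z
    by (simp add: f cob3_cob2)
  moreover have "f' v v v = diagonal f v" for v
  proof -
    have "f' v v v = diagonal f' v"
      using n by (simp add: f'_def[abs_def] diagonal_def normalized3_def)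
    also have "\<dots> = diagonal f v + diagonal (cob2 g) v"
      by (simp add: diagonal_def f'_def algebra_simps)
    finally show ?thesis
      by (simp add: diagonal_cob2 bit_vec_add_self)
  qed
  ultimately show thesis
    using that n f'_def unfolding f'_def[abs_def] by blast
qed

lemma diagonal_represented:
  fixes f :: "bit ^ 'n \<Rightarrow> bit ^ 'n \<Rightarrow> bit ^ 'n \<Rightarrow> 'a"
  assumes f: "\<And>u v w z. cob3 f u v w z = 0"
  shows "represented 3 w (diagonal f)"
proof -
  obtain f' g where "\<And>u v w z. cob3 f' u v w z = 0" "normalized3 f'"
      "\<And>v. f' v v v = diagonal f v"
    using normalized_representative[OF f] by metis
  then show ?thesis
    using cocycle_3_represented[of f' UNIV] by simp
qed

lemma diagonal_zero_imp_coboundary: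
  fixes f :: "bit ^ 'n \<Rightarrow> bit ^ 'n \<Rightarrow> bit ^ 'n \<Rightarrow> 'a"
  assumes f: "\<And>u v w z. cob3 f u v w z = 0" and diag: "\<And>v. diagonal f v = 0"
  obtains g where "\<And>u v w. f u v w = cob2 g u v w"
proof -
  obtain f' g where f': "\<And>u v w z. cob3 f' u v w z = 0" "normalized3 f'"
      "\<And>v. f' v v v = diagonal f v" "\<And>u v w. f' u v w = f u v w + cob2 g u v w"
    using normalized_representative[OF f] by metis
  obtain g' where "\<And>u v w. f' u v w = cob2 g' u v w"
    using cocycle_3_trivial[of f' UNIV] f' diag by auto
  then have "f u v w = cob2 g' u v w - cob2 g u v w" for u v w
    using f'(4)[of u v w] by simp
  also have "cob2 g' u v w - cob2 g u v w = cob2 (\<lambda>u v. g' u v - g u v) u v w" for u v w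
    by (simp add: cob2_def algebra_simps)
  finally have "f u v w = cob2 (\<lambda>u v. g' u v - g u v) u v w" for u v w .
  then show thesis using that by blast
qed

end

section \<open>Realizing cubic forms as diagonals of cocycles\<close>

lemma monomial_Suc_degree:
  fixes m :: "('n::finite) \<Rightarrow>\<^sub>0 nat"
  assumes "(\<Sum>i\<in>UNIV. Poly_Mapping.lookup m i) = Suc d"
  obtains i m' where "m = Poly_Mapping.single i 1 + m'" "(\<Sum>i\<in>UNIV. Poly_Mapping.lookup m' i) = d"
proof -
  obtain i where i: "Poly_Mapping.lookup m i > 0"
    using assms by (metis sum.neutral gr0I nat.distinct(1))
  define m' where "m' = m - Poly_Mapping.single i 1"
  have m: "m = Poly_Mapping.single i 1 + m'"
    using i by (intro poly_mapping_eqI) (auto simp: m'_def lookup_add lookup_minus lookup_single when_def)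
  have "(\<Sum>i\<in>UNIV. Poly_Mapping.lookup m i) = 1 + (\<Sum>i\<in>UNIV. Poly_Mapping.lookup m' i)"
    by (subst m) (simp add: lookup_add sum.distrib lookup_single when_def)
  with assms m that show thesis by simp
qed

lemma cubic_monomial:
  fixes m :: "('n::finite) \<Rightarrow>\<^sub>0 nat"
  assumes "(\<Sum>i\<in>UNIV. Poly_Mapping.lookup m i) = 3"
  obtains a b c where "\<And>\<sigma>. monomial_value \<sigma> m = \<sigma> a * \<sigma> b * (\<sigma> c :: bit)"
proof -
  have "(\<Sum>i\<in>UNIV. Poly_Mapping.lookup m i) = Suc (Suc (Suc 0))"
    using assms by simp
  then obtain a b c m' where m: "m = Poly_Mapping.single a 1 + (Poly_Mapping.single b 1 +
      (Poly_Mapping.single c 1 + m'))" "(\<Sum>i\<in>UNIV. Poly_Mapping.lookup m' i) = 0"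
    by (metis monomial_Suc_degree)
  then have "m' = 0"
    by (intro poly_mapping_eqI) simp
  with m show thesis
    by (intro that[of a b c]) (simp add: monomial_value_add mult.assoc)
qed

text \<open>A cubic monomial x_a x_b x_c, with repetitions allowed, is the diagonal of the trilinear
  cochain \<open>h\<close>, the cup product of three coordinates with values in {0, w}. Trilinearity
  makes it a cocycle, and its value at \<open>(v, 0, v)\<close> is 0.\<close>

lemma cubic_is_diagonal:
  fixes p :: "('n::finite) F2_poly"
  assumes p: "p \<in> homogeneous_polys 3"
  obtains f where "\<And>u v w z. cob3 f u v w z = 0" "\<And>v. diagonal f v = scale_bit (F2_eval p v) w"
proof -
  have "\<exists>f. (\<forall>x y z r. cob3 f x y z r = 0) \<and>
      (\<forall>v. diagonal f v = scale_bit (\<Sum>m\<in>F. monomial_value (($) v) m) w)"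
    if "finite F" "F \<subseteq> Poly_Mapping.keys p" for F
    using that
  proof (induction F rule: finite_induct)
    case empty
    show ?case
      by (intro exI[of _ "\<lambda>_ _ _. 0"]) (simp add: cob3_def diagonal_def)
  next
    case (insert m F)
    obtain f where f: "\<And>x y z r. cob3 f x y z r = 0"
        "\<And>v. diagonal f v = scale_bit (\<Sum>m\<in>F. monomial_value (($) v) m) w"
      using insert by blast
    obtain a b c where abc: "\<And>\<sigma>. monomial_value \<sigma> m = \<sigma> a * \<sigma> b * (\<sigma> c :: bit)"
      using p insert.prems by (auto simp: homogeneous_polys_def intro: cubic_monomial[of m])
    define h where "h x y z = scale_bit (x $ a * y $ b * z $ c) w" for x y z :: "bit ^ 'n"
    have add: "scale_bit (i + j) w = scale_bit i w + scale_bit j w" for i j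
      by (rule scale_bit_add_left[OF w])
    have "cob3 h x y z r = 0" for x y z r
      unfolding cob3_def h_def vector_add_component distrib_left distrib_right add by simp
    moreover have "cob3 (\<lambda>x y z. h x y z + f x y z) x y z r = cob3 h x y z r + cob3 f x y z r" for x y z r
      by (simp add: cob3_def algebra_simps)
    ultimately have "cob3 (\<lambda>x y z. h x y z + f x y z) x y z r = 0" for x y z r
      by (simp add: f(1))
    moreover have "diagonal (\<lambda>x y z. h x y z + f x y z) v =
        scale_bit (\<Sum>m\<in>insert m F. monomial_value (($) v) m) w" for v
    proof -
      have "diagonal (\<lambda>x y z. h x y z + f x y z) v = diagonal h v + diagonal f v"
        by (simp add: diagonal_def algebra_simps)
      also have "diagonal h v = scale_bit (monomial_value (($) v) m) w"
        by (simp add: diagonal_def h_def abc)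
      finally show ?thesis
        unfolding sum.insert[OF insert.hyps] add f(2) .
    qed
    ultimately show ?case by blast
  qed
  from this[of "Poly_Mapping.keys p"] show thesis
    using that by (auto simp: F2_eval_def poly_value_def)
qed

end

section \<open>Quotients of modules by kernels\<close>

text \<open>With cosets seen as fibres, two different quotients can be compared through their values
  in \<open>Q\<close>.\<close>

lemma kernel_rcos_eq_fibre:
  assumes "Group.group Z" "Group.group Q" "\<Psi> \<in> hom Z Q" "x \<in> carrier Z"
  shows "kernel Z Q \<Psi> #>\<^bsub>Z\<^esub> x = {y \<in> carrier Z. \<Psi> y = \<Psi> x}"
proof -
  interpret group_hom Z Q \<Psi>
    using assms by (simp add: group_hom_def group_hom_axioms_def)
  show ?thesis
  proof (intro equalityI subsetI)
    fix y assume "y \<in> kernel Z Q \<Psi> #>\<^bsub>Z\<^esub> x"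
    then show "y \<in> {y \<in> carrier Z. \<Psi> y = \<Psi> x}"
      using assms(4) by (auto simp: r_coset_def kernel_def)
  next
    fix y assume y: "y \<in> {y \<in> carrier Z. \<Psi> y = \<Psi> x}"
    have "y \<otimes>\<^bsub>Z\<^esub> inv\<^bsub>Z\<^esub> x \<in> kernel Z Q \<Psi>"
      using assms(4) y by (simp add: kernel_def)
    moreover have "y = (y \<otimes>\<^bsub>Z\<^esub> inv\<^bsub>Z\<^esub> x) \<otimes>\<^bsub>Z\<^esub> x"
      using assms(4) y by (simp add: G.m_assoc)
    ultimately show "y \<in> kernel Z Q \<Psi> #>\<^bsub>Z\<^esub> x"
      unfolding r_coset_def by blast
  qed
qed

text \<open>Equivariance sends a fibre into a fibre; applying the inverse of \<open>g\<close> shows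
  that all of it is reached.\<close>

lemma image_fibre:
  assumes \<Gamma>: "Group.group \<Gamma>" and g: "g \<in> carrier \<Gamma>"
    and T: "\<And>g. g \<in> carrier \<Gamma> \<Longrightarrow> T g \<in> hom Z Z"
      "\<And>x. x \<in> carrier Z \<Longrightarrow> T \<one>\<^bsub>\<Gamma>\<^esub> x = x"
      "\<And>g h x. g \<in> carrier \<Gamma> \<Longrightarrow> h \<in> carrier \<Gamma> \<Longrightarrow> x \<in> carrier Z \<Longrightarrow> T (g \<otimes>\<^bsub>\<Gamma>\<^esub> h) x = T g (T h x)"
    and U: "\<And>g x. g \<in> carrier \<Gamma> \<Longrightarrow> x \<in> carrier Z \<Longrightarrow> \<Psi> (T g x) = U g (\<Psi> x)"
    and x: "x \<in> carrier Z"
  shows "T g ` {y \<in> carrier Z. \<Psi> y = \<Psi> x} = {y \<in> carrier Z. \<Psi> y = \<Psi> (T g x)}"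
proof -
  interpret \<Gamma>: group \<Gamma> by (rule \<Gamma>)
  have closed: "T g x \<in> carrier Z" if "g \<in> carrier \<Gamma>" "x \<in> carrier Z" for g x
    using T(1)[OF that(1)] that(2) by (rule hom_in_carrier)
  show ?thesis
  proof (intro equalityI subsetI)
    fix y assume "y \<in> T g ` {y \<in> carrier Z. \<Psi> y = \<Psi> x}"
    then show "y \<in> {y \<in> carrier Z. \<Psi> y = \<Psi> (T g x)}"
      using g x closed U by auto
  next
    fix y assume y: "y \<in> {y \<in> carrier Z. \<Psi> y = \<Psi> (T g x)}"
    let ?z = "T (inv\<^bsub>\<Gamma>\<^esub> g) y"
    have "T g ?z = y"
      using T(3)[of g "inv\<^bsub>\<Gamma>\<^esub> g" y] T(2) g y by simp
    moreover have "\<Psi> ?z = \<Psi> (T (inv\<^bsub>\<Gamma>\<^esub> g) (T g x))"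
      using y g x closed U by simp
    then have "\<Psi> ?z = \<Psi> x"
      using T(3)[of "inv\<^bsub>\<Gamma>\<^esub> g" g x] T(2) g x by simp
    ultimately show "y \<in> T g ` {y \<in> carrier Z. \<Psi> y = \<Psi> x}"
      using closed[of "inv\<^bsub>\<Gamma>\<^esub> g" y] g y by (intro image_eqI[of _ _ ?z]) auto
  qed
qed

text \<open>The action takes images of cosets, as \<open>pullback_cohomology\<close> and
  \<open>GL_S3_quotient_action\<close> do. Such an image is again a coset, so the module axioms
  descend from representatives.\<close>

lemma group_module_quotient:
  assumes \<Gamma>: "Group.group \<Gamma>" and Z: "comm_group Z" and Q: "Group.group Q"
    and \<Psi>: "\<Psi> \<in> hom Z Q"
    and T: "\<And>g. g \<in> carrier \<Gamma> \<Longrightarrow> T g \<in> hom Z Z"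
      "\<And>x. x \<in> carrier Z \<Longrightarrow> T \<one>\<^bsub>\<Gamma>\<^esub> x = x"
      "\<And>g h x. g \<in> carrier \<Gamma> \<Longrightarrow> h \<in> carrier \<Gamma> \<Longrightarrow> x \<in> carrier Z \<Longrightarrow> T (g \<otimes>\<^bsub>\<Gamma>\<^esub> h) x = T g (T h x)"
    and U: "\<And>g x. g \<in> carrier \<Gamma> \<Longrightarrow> x \<in> carrier Z \<Longrightarrow> \<Psi> (T g x) = U g (\<Psi> x)"
  shows "group_module \<Gamma> (Z Mod kernel Z Q \<Psi>) (\<lambda>g c. T g ` c)"
    and "\<And>g x. g \<in> carrier \<Gamma> \<Longrightarrow> x \<in> carrier Z \<Longrightarrow>
      T g ` (kernel Z Q \<Psi> #>\<^bsub>Z\<^esub> x) = kernel Z Q \<Psi> #>\<^bsub>Z\<^esub> T g x"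
proof -
  interpret \<Gamma>: group \<Gamma> by (rule \<Gamma>)
  interpret Z: comm_group Z by (rule Z)
  interpret group_hom Z Q \<Psi>
    using Q \<Psi> by (simp add: group_hom_def group_hom_axioms_def Z.is_group)
  interpret K: normal "kernel Z Q \<Psi>" Z by (rule normal_kernel)
  let ?K = "kernel Z Q \<Psi>"
  have closed: "T g x \<in> carrier Z" if "g \<in> carrier \<Gamma>" "x \<in> carrier Z" for g x
    using T(1)[OF that(1)] that(2) by (rule hom_in_carrier)
  have coset: "T g ` (?K #>\<^bsub>Z\<^esub> x) = ?K #>\<^bsub>Z\<^esub> T g x" if "g \<in> carrier \<Gamma>" "x \<in> carrier Z" for g x
    using that image_fibre[of \<Gamma> g T Z \<Psi> U x, OF \<Gamma> that(1) T U that(2)]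
    by (simp add: kernel_rcos_eq_fibre[OF Z.is_group Q \<Psi>] closed)
  show "T g ` (?K #>\<^bsub>Z\<^esub> x) = ?K #>\<^bsub>Z\<^esub> T g x" if "g \<in> carrier \<Gamma>" "x \<in> carrier Z" for g x
    using coset that .
  show "group_module \<Gamma> (Z Mod ?K) (\<lambda>g c. T g ` c)"
    unfolding group_module_def
  proof (intro conjI ballI)
    show "Group.group \<Gamma>" by (rule \<Gamma>)
    show "comm_group (Z Mod ?K)"
      by (rule Z.abelian_FactGroup) (rule subgroup_kernel)
    show "(`) (T g) \<in> hom (Z Mod ?K) (Z Mod ?K)" if g: "g \<in> carrier \<Gamma>" for g
    proof (rule homI)
      show "T g ` c \<in> carrier (Z Mod ?K)" if "c \<in> carrier (Z Mod ?K)" for c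
        using that g by (auto simp: carrier_FactGroup coset closed)
      show "T g ` (c \<otimes>\<^bsub>Z Mod ?K\<^esub> d) = T g ` c \<otimes>\<^bsub>Z Mod ?K\<^esub> T g ` d"
        if cd: "c \<in> carrier (Z Mod ?K)" "d \<in> carrier (Z Mod ?K)" for c d
      proof -
        obtain x y where xy: "x \<in> carrier Z" "y \<in> carrier Z" "c = ?K #>\<^bsub>Z\<^esub> x" "d = ?K #>\<^bsub>Z\<^esub> y"
          using cd by (auto simp: carrier_FactGroup)
        show ?thesis
          using xy g by (simp add: coset K.rcos_sum closed Group.hom_mult[OF T(1)[OF g]])
      qed
    qed
    show "T \<one>\<^bsub>\<Gamma>\<^esub> ` c = c" if c: "c \<in> carrier (Z Mod ?K)" for c
    proof -
      obtain x where "x \<in> carrier Z" "c = ?K #>\<^bsub>Z\<^esub> x"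
        using c by (auto simp: carrier_FactGroup)
      then show ?thesis
        using coset[of "\<one>\<^bsub>\<Gamma>\<^esub>" x] by (simp add: T(2))
    qed
    show "T (g \<otimes>\<^bsub>\<Gamma>\<^esub> h) ` c = T g ` (T h ` c)"
      if "g \<in> carrier \<Gamma>" "h \<in> carrier \<Gamma>" "c \<in> carrier (Z Mod ?K)" for g h c
    proof -
      obtain x where "x \<in> carrier Z" "c = ?K #>\<^bsub>Z\<^esub> x"
        using \<open>c \<in> carrier (Z Mod ?K)\<close> by (auto simp: carrier_FactGroup)
      then show ?thesis
        using that(1,2) by (simp add: coset closed T(3) del: image_image)
    qed
  qed
qed

text \<open>The isomorphism identifies the two fibres over each point of the common image.\<close>

lemma group_module_isomorphic_quotients:
  assumes \<Gamma>: "Group.group \<Gamma>" and Z: "comm_group Z" "comm_group Z'" and Q: "Group.group Q"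
    and \<Psi>: "\<Psi> \<in> hom Z Q" "\<Psi>' \<in> hom Z' Q" "\<Psi> ` carrier Z = \<Psi>' ` carrier Z'"
    and T: "\<And>g. g \<in> carrier \<Gamma> \<Longrightarrow> T g \<in> hom Z Z"
      "\<And>x. x \<in> carrier Z \<Longrightarrow> T \<one>\<^bsub>\<Gamma>\<^esub> x = x"
      "\<And>g h x. g \<in> carrier \<Gamma> \<Longrightarrow> h \<in> carrier \<Gamma> \<Longrightarrow> x \<in> carrier Z \<Longrightarrow> T (g \<otimes>\<^bsub>\<Gamma>\<^esub> h) x = T g (T h x)"
    and T': "\<And>g. g \<in> carrier \<Gamma> \<Longrightarrow> T' g \<in> hom Z' Z'"
      "\<And>x. x \<in> carrier Z' \<Longrightarrow> T' \<one>\<^bsub>\<Gamma>\<^esub> x = x"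
      "\<And>g h x. g \<in> carrier \<Gamma> \<Longrightarrow> h \<in> carrier \<Gamma> \<Longrightarrow> x \<in> carrier Z' \<Longrightarrow> T' (g \<otimes>\<^bsub>\<Gamma>\<^esub> h) x = T' g (T' h x)"
    and U: "\<And>g x. g \<in> carrier \<Gamma> \<Longrightarrow> x \<in> carrier Z \<Longrightarrow> \<Psi> (T g x) = U g (\<Psi> x)"
      "\<And>g x. g \<in> carrier \<Gamma> \<Longrightarrow> x \<in> carrier Z' \<Longrightarrow> \<Psi>' (T' g x) = U g (\<Psi>' x)"
  shows "group_module_isomorphic \<Gamma>
    (Z Mod kernel Z Q \<Psi>) (\<lambda>g c. T g ` c) (Z' Mod kernel Z' Q \<Psi>') (\<lambda>g c. T' g ` c)"
proof -
  interpret Z: comm_group Z by (rule Z)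
  interpret Z': comm_group Z' by (rule Z)
  interpret h: group_hom Z Q \<Psi>
    using Q \<Psi> by (simp add: group_hom_def group_hom_axioms_def Z.is_group)
  interpret h': group_hom Z' Q \<Psi>'
    using Q \<Psi> by (simp add: group_hom_def group_hom_axioms_def Z'.is_group)
  let ?K = "kernel Z Q \<Psi>" and ?K' = "kernel Z' Q \<Psi>'"
  interpret K: normal ?K Z by (rule h.normal_kernel)
  interpret K': normal ?K' Z' by (rule h'.normal_kernel)
  note fibre = kernel_rcos_eq_fibre[OF Z.is_group Q \<Psi>(1)]
  note fibre' = kernel_rcos_eq_fibre[OF Z'.is_group Q \<Psi>(2)]
  have coset: "T g ` (?K #>\<^bsub>Z\<^esub> x) = ?K #>\<^bsub>Z\<^esub> T g x" if "g \<in> carrier \<Gamma>" "x \<in> carrier Z" for g x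
    using that by (intro group_module_quotient(2)[of \<Gamma> Z Q \<Psi> T U] \<Gamma> Z Q \<Psi>(1) T U(1))
  have coset': "T' g ` (?K' #>\<^bsub>Z'\<^esub> x) = ?K' #>\<^bsub>Z'\<^esub> T' g x" if "g \<in> carrier \<Gamma>" "x \<in> carrier Z'" for g x
    using that by (intro group_module_quotient(2)[of \<Gamma> Z' Q \<Psi>' T' U] \<Gamma> Z Q \<Psi>(2) T' U(2))
  define \<phi> where "\<phi> c = {y \<in> carrier Z'. \<Psi>' y \<in> \<Psi> ` c}" for c
  have \<phi>: "\<phi> (?K #>\<^bsub>Z\<^esub> x) = ?K' #>\<^bsub>Z'\<^esub> y" if "x \<in> carrier Z" "y \<in> carrier Z'" "\<Psi> x = \<Psi>' y" for x y
    using that by (auto simp: \<phi>_def fibre fibre')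
  have ex': "\<exists>y\<in>carrier Z'. \<Psi> x = \<Psi>' y" if "x \<in> carrier Z" for x
    using that \<Psi>(3) by blast
  have ex: "\<exists>x\<in>carrier Z. \<Psi> x = \<Psi>' y" if "y \<in> carrier Z'" for y
    using that \<Psi>(3) by (metis imageE image_eqI)
  have "\<phi> \<in> hom (Z Mod ?K) (Z' Mod ?K')"
  proof (rule homI)
    show "\<phi> c \<in> carrier (Z' Mod ?K')" if "c \<in> carrier (Z Mod ?K)" for c
      using that ex' \<phi> by (force simp: carrier_FactGroup)
    show "\<phi> (c \<otimes>\<^bsub>Z Mod ?K\<^esub> d) = \<phi> c \<otimes>\<^bsub>Z' Mod ?K'\<^esub> \<phi> d"
      if cd: "c \<in> carrier (Z Mod ?K)" "d \<in> carrier (Z Mod ?K)" for c d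
    proof -
      obtain x y where xy: "x \<in> carrier Z" "y \<in> carrier Z" "c = ?K #>\<^bsub>Z\<^esub> x" "d = ?K #>\<^bsub>Z\<^esub> y"
        using cd by (auto simp: carrier_FactGroup)
      obtain x' y' where x'y': "x' \<in> carrier Z'" "y' \<in> carrier Z'" "\<Psi> x = \<Psi>' x'" "\<Psi> y = \<Psi>' y'"
        using ex' xy by meson
      have "\<phi> (c \<otimes>\<^bsub>Z Mod ?K\<^esub> d) = \<phi> (?K #>\<^bsub>Z\<^esub> (x \<otimes>\<^bsub>Z\<^esub> y))"
        using xy by (simp add: K.rcos_sum)
      also have "\<dots> = ?K' #>\<^bsub>Z'\<^esub> (x' \<otimes>\<^bsub>Z'\<^esub> y')"
        using xy x'y' by (intro \<phi>) simp_all
      also have "\<dots> = \<phi> c \<otimes>\<^bsub>Z' Mod ?K'\<^esub> \<phi> d"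
        using xy x'y' by (simp add: K'.rcos_sum \<phi>[of x x'] \<phi>[of y y'])
      finally show ?thesis .
    qed
  qed
  moreover have "bij_betw \<phi> (carrier (Z Mod ?K)) (carrier (Z' Mod ?K'))"
    unfolding bij_betw_def
  proof (intro conjI)
    show "inj_on \<phi> (carrier (Z Mod ?K))"
    proof (rule inj_onI)
      fix c d assume cd: "c \<in> carrier (Z Mod ?K)" "d \<in> carrier (Z Mod ?K)" and eq: "\<phi> c = \<phi> d"
      obtain x y where xy: "x \<in> carrier Z" "y \<in> carrier Z" "c = ?K #>\<^bsub>Z\<^esub> x" "d = ?K #>\<^bsub>Z\<^esub> y"
        using cd by (auto simp: carrier_FactGroup)
      obtain x' y' where x'y': "x' \<in> carrier Z'" "y' \<in> carrier Z'" "\<Psi> x = \<Psi>' x'" "\<Psi> y = \<Psi>' y'"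
        using ex' xy by meson
      have "?K' #>\<^bsub>Z'\<^esub> x' = ?K' #>\<^bsub>Z'\<^esub> y'"
        using eq xy x'y' by (simp add: \<phi>[of x x'] \<phi>[of y y'])
      then have "\<Psi>' x' = \<Psi>' y'"
        using x'y' by (auto simp: fibre')
      then show "c = d"
        using xy x'y' by (simp add: fibre)
    qed
    show "\<phi> ` carrier (Z Mod ?K) = carrier (Z' Mod ?K')"
    proof (intro equalityI subsetI)
      fix c assume "c \<in> \<phi> ` carrier (Z Mod ?K)"
      then show "c \<in> carrier (Z' Mod ?K')"
        using ex' \<phi> by (force simp: carrier_FactGroup)
    next
      fix c assume "c \<in> carrier (Z' Mod ?K')"
      then obtain y where y: "y \<in> carrier Z'" "c = ?K' #>\<^bsub>Z'\<^esub> y"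
        by (auto simp: carrier_FactGroup)
      then obtain x where "x \<in> carrier Z" "\<Psi> x = \<Psi>' y"
        using ex by meson
      then show "c \<in> \<phi> ` carrier (Z Mod ?K)"
        using y \<phi>[of x y] by (auto simp: carrier_FactGroup)
    qed
  qed
  ultimately have "\<phi> \<in> Group.iso (Z Mod ?K) (Z' Mod ?K')"
    by (simp add: iso_def)
  moreover have "\<phi> (T g ` c) = T' g ` \<phi> c" if g: "g \<in> carrier \<Gamma>" and c: "c \<in> carrier (Z Mod ?K)" for g c
  proof -
    obtain x where x: "x \<in> carrier Z" "c = ?K #>\<^bsub>Z\<^esub> x"
      using c by (auto simp: carrier_FactGroup)
    then obtain y where y: "y \<in> carrier Z'" "\<Psi> x = \<Psi>' y"
      using ex' by meson
    have closed: "T g x \<in> carrier Z" "T' g y \<in> carrier Z'"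
      using hom_in_carrier[OF T(1)[OF g] x(1)] hom_in_carrier[OF T'(1)[OF g] y(1)] by simp_all
    have "\<phi> (T g ` c) = \<phi> (?K #>\<^bsub>Z\<^esub> T g x)"
      by (simp add: x coset[OF g])
    also have "\<dots> = ?K' #>\<^bsub>Z'\<^esub> T' g y"
      using closed y x g by (intro \<phi>) (simp_all add: U)
    also have "\<dots> = T' g ` \<phi> c"
      using \<phi>[OF x(1) y] by (simp add: x(2) coset'[OF g y(1)])
    finally show ?thesis .
  qed
  moreover have "group_module \<Gamma> (Z Mod ?K) (\<lambda>g c. T g ` c)"
    by (intro group_module_quotient(1)[of \<Gamma> Z Q \<Psi> T U] \<Gamma> Z Q \<Psi>(1) T U(1))
  moreover have "group_module \<Gamma> (Z' Mod ?K') (\<lambda>g c. T' g ` c)"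
    by (intro group_module_quotient(1)[of \<Gamma> Z' Q \<Psi>' T' U] \<Gamma> Z Q \<Psi>(2) T' U(2))
  ultimately show ?thesis
    unfolding group_module_isomorphic_def by blast
qed

section \<open>Cochains with values in the multiplicative group\<close>

text \<open>An additive type of units, to which the lemmas for \<open>ab_group_add\<close> apply:
  2-torsion elements are square roots of 1, and halves are square roots.\<close>

typedef (overloaded) 'k mult_units = "{a :: 'k::field. a \<noteq> 0}"
  morphisms unit_val Abs_unit
  by (rule exI[of _ 1]) simp

setup_lifting type_definition_mult_units

instantiation mult_units :: (field) ab_group_add
begin

lift_definition zero_mult_units :: "'a mult_units" is 1 by simp
lift_definition plus_mult_units :: "'a mult_units \<Rightarrow> 'a mult_units \<Rightarrow> 'a mult_units" is "(*)" by simp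
lift_definition uminus_mult_units :: "'a mult_units \<Rightarrow> 'a mult_units" is inverse by simp
lift_definition minus_mult_units :: "'a mult_units \<Rightarrow> 'a mult_units \<Rightarrow> 'a mult_units" is "(/)" by simp

instance
  by standard (transfer; simp add: field_simps)+

end

lemma unit_val_simps [simp]:
  "unit_val 0 = 1" "unit_val (a + b) = unit_val a * unit_val b"
  "unit_val (- a) = inverse (unit_val a)" "unit_val (a - b) = unit_val a / unit_val b"
  "unit_val a \<noteq> 0"
  by (transfer; simp)+

lemma mult_units_divisible: "\<exists>b :: 'k::alg_closed_field mult_units. b + b = a"
proof transfer
  fix a :: 'k
  assume "a \<noteq> 0"
  moreover obtain b where "b ^ 2 = a"
    using nth_root_exists[of 2 a] by auto
  ultimately show "\<exists>b\<in>{a. a \<noteq> 0}. b * b = a"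
    by (intro bexI[of _ b]) (auto simp: power2_eq_square)
qed

lift_definition minus_one_unit :: "'k::field mult_units" is "- 1" by simp

lemma minus_one_unit_add_self: "minus_one_unit + minus_one_unit = 0"
  by transfer simp

lemma mult_units_torsion: "a + a = 0 \<Longrightarrow> a = 0 \<or> a = minus_one_unit"
  by transfer (simp add: square_eq_1_iff)

text \<open>This makes the values of a form recoverable from its sign function, as
  \<open>kernel_poly_sign\<close> requires.\<close>

lemma minus_one_unit_neq_0: "minus_one_unit \<noteq> (0 :: 'k::field_char_0 mult_units)"
  by transfer simp

lemma comm_group_unit_group: "comm_group (unit_group :: 'k::field monoid)"
proof (rule comm_groupI)
  fix x :: 'k
  assume "x \<in> carrier unit_group"
  then show "\<exists>y\<in>carrier unit_group. y \<otimes>\<^bsub>unit_group\<^esub> x = \<one>\<^bsub>unit_group\<^esub>"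
    by (intro bexI[of _ "inverse x"]) (simp_all add: unit_group_def)
qed (simp_all add: unit_group_def)

lemma inv_unit_group: "a \<noteq> 0 \<Longrightarrow> inv\<^bsub>unit_group\<^esub> a = inverse (a :: 'k::field)"
  using comm_group_unit_group[where 'k = 'k]
  by (intro group.inv_equality) (auto simp: comm_group_def unit_group_def)

lemma unit_group_int_pow:
  "a \<noteq> 0 \<Longrightarrow> a [^]\<^bsub>unit_group\<^esub> (1::int) = (a :: 'k::field)"
  "a \<noteq> 0 \<Longrightarrow> a [^]\<^bsub>unit_group\<^esub> (- 1::int) = inverse a"
proof -
  interpret comm_group "unit_group :: 'k monoid" by (rule comm_group_unit_group)
  show "a [^]\<^bsub>unit_group\<^esub> (1::int) = a" "a [^]\<^bsub>unit_group\<^esub> (- 1::int) = inverse a" if "a \<noteq> 0"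
    using that inv_unit_group[OF that] int_pow_neg[of a 1] int_pow_1[of a]
    by (simp_all add: unit_group_def)
qed

section \<open>Cochain groups and their curried form\<close>

lemma comm_group_cochain_group:
  assumes "comm_group A"
  shows "comm_group (cochain_group G A n)"
proof -
  interpret A: comm_group A by (rule assms)
  show ?thesis
  proof (rule comm_groupI)
    fix f assume f: "f \<in> carrier (cochain_group G A n)"
    show "\<exists>h\<in>carrier (cochain_group G A n). h \<otimes>\<^bsub>cochain_group G A n\<^esub> f = \<one>\<^bsub>cochain_group G A n\<^esub>"
      using f by (intro bexI[of _ "\<lambda>xs\<in>tuples G n. inv\<^bsub>A\<^esub> f xs"])
        (auto simp: cochain_group_def PiE_iff fun_eq_iff)
  qed (auto simp: cochain_group_def PiE_iff fun_eq_iff extensional_def A.m_ac)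
qed

text \<open>\<open>Abs_unit\<close> is meaningful at nonzero arguments. Members of
  \<open>V_cochains\<close> are nonzero on lists of the right length, hence the membership
  assumptions in the lemmas about currying.\<close>

definition curry2 :: "('v list \<Rightarrow> 'k::field) \<Rightarrow> 'v \<Rightarrow> 'v \<Rightarrow> 'k mult_units" where
  "curry2 f u v = Abs_unit (f [u, v])"

definition curry3 :: "('v list \<Rightarrow> 'k::field) \<Rightarrow> 'v \<Rightarrow> 'v \<Rightarrow> 'v \<Rightarrow> 'k mult_units" where
  "curry3 f u v w = Abs_unit (f [u, v, w])"

abbreviation V_cochains :: "nat \<Rightarrow> ((bit ^ 'n) list \<Rightarrow> 'k::field) monoid" where
  "V_cochains \<equiv> cochain_group V_group unit_group"

lemma tuples_V_group: "tuples V_group n = {xs. length xs = n}"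
  by (simp add: tuples_def V_group_def)

lemma V_cochain_nonzero: "f \<in> carrier (V_cochains n) \<Longrightarrow> length xs = n \<Longrightarrow> f xs \<noteq> 0"
  by (auto simp: cochain_group_def tuples_V_group unit_group_def)

lemma V_cochain_eqI:
  assumes "f \<in> carrier (V_cochains n)" "h \<in> carrier (V_cochains n)"
    "\<And>xs. length xs = n \<Longrightarrow> f xs = h xs"
  shows "f = h"
  using assms by (auto simp: cochain_group_def tuples_V_group intro: PiE_ext)

lemma unit_val_curry2: "f \<in> carrier (V_cochains 2) \<Longrightarrow> unit_val (curry2 f u v) = f [u, v]"
  unfolding curry2_def by (rule Abs_unit_inverse) (simp add: V_cochain_nonzero)

lemma unit_val_curry3: "f \<in> carrier (V_cochains 3) \<Longrightarrow> unit_val (curry3 f u v w) = f [u, v, w]"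
  unfolding curry3_def by (rule Abs_unit_inverse) (simp add: V_cochain_nonzero)

lemma coboundary_closed:
  assumes "comm_group A" "f \<in> carrier (cochain_group G A n)" "Group.group G"
  shows "coboundary G A n f \<in> carrier (cochain_group G A (Suc n))"
proof -
  interpret A: comm_group A by (rule assms)
  interpret G: group G by (rule assms)
  have f: "f xs \<in> carrier A" if "xs \<in> tuples G n" for xs
    using assms(2) that by (auto simp: cochain_group_def)
  have "tl xs \<in> tuples G n" if "xs \<in> tuples G (Suc n)" for xs
    using that by (cases xs) (auto simp: tuples_def)
  moreover have "butlast xs \<in> tuples G n" if "xs \<in> tuples G (Suc n)" for xs
    using that by (auto simp: tuples_def dest: in_set_butlastD)
  moreover have "merge_at G i xs \<in> tuples G n" if "xs \<in> tuples G (Suc n)" "i < n" for xs i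
    using that set_take_subset[of i xs] set_drop_subset[of "Suc (Suc i)" xs]
    by (auto simp: tuples_def merge_at_def subset_iff)
  ultimately show ?thesis
    unfolding coboundary_def by (auto simp: cochain_group_def f intro!: A.finprod_closed)
qed

lemma merge_at_simps:
  "merge_at G 0 (x # y # xs) = (x \<otimes>\<^bsub>G\<^esub> y) # xs"
  "merge_at G (Suc i) (x # xs) = x # merge_at G i xs"
  by (simp_all add: merge_at_def)

lemma coboundary_V_2:
  assumes f: "f \<in> carrier (V_cochains 2)"
  shows "coboundary V_group unit_group 2 f [a, b, c] = unit_val (cob2 (curry2 f) a b c)"
proof -
  interpret U: comm_group "unit_group :: 'b monoid" by (rule comm_group_unit_group)
  have nz: "f [x, y] \<noteq> 0" for x y
    using f by (rule V_cochain_nonzero) simp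
  have carr: "x \<noteq> 0 \<Longrightarrow> x \<in> carrier (unit_group :: 'b monoid)" for x
    by (simp add: unit_group_def)
  have "{..<2} = {0, Suc 0}" by auto
  then show ?thesis
    by (simp add: coboundary_def tuples_V_group merge_at_simps unit_group_int_pow nz carr
        cob2_def unit_val_curry2[OF f])
      (simp add: unit_group_def V_group_def field_simps nz)
qed

lemma coboundary_V_3:
  assumes f: "f \<in> carrier (V_cochains 3)"
  shows "coboundary V_group unit_group 3 f [a, b, c, d] = unit_val (cob3 (curry3 f) a b c d)"
proof -
  interpret U: comm_group "unit_group :: 'b monoid" by (rule comm_group_unit_group)
  have nz: "f [x, y, z] \<noteq> 0" for x y z
    using f by (rule V_cochain_nonzero) simp
  have carr: "x \<noteq> 0 \<Longrightarrow> x \<in> carrier (unit_group :: 'b monoid)" for x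
    by (simp add: unit_group_def)
  have "{..<3} = {0, Suc 0, Suc (Suc 0)}" by auto
  then show ?thesis
    by (simp add: coboundary_def tuples_V_group merge_at_simps unit_group_int_pow nz carr
        cob3_def unit_val_curry3[OF f])
      (simp add: unit_group_def V_group_def field_simps nz)
qed

section \<open>The isomorphism\<close>

lemma matrix_inv_inverse:
  assumes "invertible A"
  shows "A ** matrix_inv A = mat 1" "matrix_inv A ** A = mat 1"
  using someI_ex[OF assms[unfolded invertible_def]] by (simp_all add: matrix_inv_def)

lemma matrix_inv_eqI:
  fixes A B :: "'a::semiring_1 ^ 'n ^ 'n"
  assumes "A ** B = mat 1" "B ** A = mat 1"
  shows "matrix_inv A = B"
proof -
  have "invertible A"
    using assms by (auto simp: invertible_def)
  then have "matrix_inv A = matrix_inv A ** (A ** B)"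
    by (simp add: assms)
  also have "\<dots> = B"
    by (simp add: matrix_mul_assoc matrix_inv_inverse[OF \<open>invertible A\<close>])
  finally show ?thesis .
qed

lemma matrix_inv_mat_1: "matrix_inv (mat 1 :: 'a::semiring_1 ^ 'n ^ 'n) = mat 1"
  by (rule matrix_inv_eqI) simp_all

lemma matrix_inv_mult:
  fixes A B :: "bit ^ 'n ^ 'n"
  assumes "invertible A" "invertible B"
  shows "matrix_inv (A ** B) = matrix_inv B ** matrix_inv A"
proof (rule matrix_inv_eqI)
  have "A ** B ** (matrix_inv B ** matrix_inv A) = A ** (B ** matrix_inv B) ** matrix_inv A"
    by (simp only: matrix_mul_assoc)
  then show "A ** B ** (matrix_inv B ** matrix_inv A) = mat 1"
    using assms by (simp add: matrix_inv_inverse)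
  have "matrix_inv B ** matrix_inv A ** (A ** B) = matrix_inv B ** (matrix_inv A ** A) ** B"
    by (simp only: matrix_mul_assoc)
  then show "matrix_inv B ** matrix_inv A ** (A ** B) = mat 1"
    using assms by (simp add: matrix_inv_inverse)
qed

lemma group_GL_group: "Group.group (GL_group :: (bit ^ 'n ^ 'n) monoid)"
proof (rule groupI)
  fix A :: "bit ^ 'n ^ 'n"
  assume "A \<in> carrier GL_group"
  then have "invertible A" by (simp add: GL_group_def)
  then show "\<exists>B\<in>carrier GL_group. B \<otimes>\<^bsub>GL_group\<^esub> A = \<one>\<^bsub>GL_group\<^esub>"
    using matrix_inv_inverse[of A]
    by (intro bexI[of _ "matrix_inv A"]) (auto simp: GL_group_def invertible_def)
next
  show "\<one>\<^bsub>GL_group\<^esub> \<in> carrier (GL_group :: (bit ^ 'n ^ 'n) monoid)"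
    using matrix_mul_lid[of "mat 1 :: bit ^ 'n ^ 'n"] by (auto simp: GL_group_def invertible_def)
qed (simp_all add: GL_group_def matrix_mul_assoc invertible_mult)

section \<open>The group of 3-cocycles and its diagonal map\<close>

definition uncurry2 :: "(bit ^ 'n \<Rightarrow> bit ^ 'n \<Rightarrow> 'k::field mult_units) \<Rightarrow> (bit ^ 'n) list \<Rightarrow> 'k" where
  "uncurry2 g = (\<lambda>xs\<in>tuples V_group 2. unit_val (g (xs ! 0) (xs ! 1)))"

definition uncurry3 ::
    "(bit ^ 'n \<Rightarrow> bit ^ 'n \<Rightarrow> bit ^ 'n \<Rightarrow> 'k::field mult_units) \<Rightarrow> (bit ^ 'n) list \<Rightarrow> 'k" where
  "uncurry3 f = (\<lambda>xs\<in>tuples V_group 3. unit_val (f (xs ! 0) (xs ! 1) (xs ! 2)))"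

lemma uncurry2: "uncurry2 g \<in> carrier (V_cochains 2)" "curry2 (uncurry2 g) = g"
  by (auto simp: uncurry2_def curry2_def cochain_group_def unit_group_def tuples_V_group
      unit_val_inverse fun_eq_iff)

lemma uncurry3: "uncurry3 f \<in> carrier (V_cochains 3)" "curry3 (uncurry3 f) = f"
  by (auto simp: uncurry3_def curry3_def cochain_group_def unit_group_def tuples_V_group
      unit_val_inverse fun_eq_iff)

lemma curry3_eqI:
  assumes "f \<in> carrier (V_cochains 3)" "h \<in> carrier (V_cochains 3)"
    "\<And>u v w. curry3 f u v w = curry3 h u v w"
  shows "f = h"
proof (rule V_cochain_eqI[OF assms(1,2)])
  fix xs :: "(bit ^ 'a) list"
  assume "length xs = 3"
  then obtain u v w where "xs = [u, v, w]"
    by (auto simp: numeral_3_eq_3 length_Suc_conv)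
  then show "f xs = h xs"
    using assms(3)[of u v w] unit_val_curry3[OF assms(1), of u v w]
      unit_val_curry3[OF assms(2), of u v w] by simp
qed

lemma group_V_group: "Group.group V_group"
  by (rule groupI) (auto simp: V_group_def add.assoc intro: exI[of _ "- x" for x])

lemma V_cochains_comm_group: "comm_group (V_cochains n)"
  by (rule comm_group_cochain_group[OF comm_group_unit_group])

lemma coboundary_V_closed:
  "f \<in> carrier (V_cochains n) \<Longrightarrow>
    coboundary V_group unit_group n f \<in> carrier (V_cochains (Suc n))"
  by (rule coboundary_closed[OF comm_group_unit_group _ group_V_group])

lemma one_V_cochains: "length xs = n \<Longrightarrow> \<one>\<^bsub>V_cochains n\<^esub> xs = 1"
  by (simp add: cochain_group_def tuples_V_group unit_group_def)

lemma curry3_mult: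
  assumes "f \<in> carrier (V_cochains 3)" "h \<in> carrier (V_cochains 3)"
  shows "curry3 (f \<otimes>\<^bsub>V_cochains 3\<^esub> h) u v w = curry3 f u v w + curry3 h u v w"
proof -
  have "f \<otimes>\<^bsub>V_cochains 3\<^esub> h \<in> carrier (V_cochains 3)"
    by (intro comm_groupE(1)[OF V_cochains_comm_group] assms)
  from unit_val_curry3[OF this, of u v w] show ?thesis
    using assms
    by (simp add: unit_val_curry3 cochain_group_def tuples_V_group unit_group_def
        flip: unit_val_inject)
qed

lemma coboundary_3_hom:
  "coboundary V_group unit_group 3 \<in> hom (V_cochains 3) (V_cochains (Suc 3))"
proof (rule homI)
  fix f h :: "(bit ^ 'a) list \<Rightarrow> 'b"
  assume fh: "f \<in> carrier (V_cochains 3)" "h \<in> carrier (V_cochains 3)"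
  interpret C3: comm_group "V_cochains 3 :: ((bit ^ 'a) list \<Rightarrow> 'b) monoid"
    by (rule V_cochains_comm_group)
  interpret C4: comm_group "V_cochains (Suc 3) :: ((bit ^ 'a) list \<Rightarrow> 'b) monoid"
    by (rule V_cochains_comm_group)
  let ?d = "coboundary V_group unit_group 3 :: ((bit ^ 'a) list \<Rightarrow> 'b) \<Rightarrow> _"
  show "?d (f \<otimes>\<^bsub>V_cochains 3\<^esub> h) = ?d f \<otimes>\<^bsub>V_cochains (Suc 3)\<^esub> ?d h"
  proof (rule V_cochain_eqI)
    show "?d (f \<otimes>\<^bsub>V_cochains 3\<^esub> h) \<in> carrier (V_cochains (Suc 3))"
      using fh by (intro coboundary_V_closed C3.m_closed)
    show "?d f \<otimes>\<^bsub>V_cochains (Suc 3)\<^esub> ?d h \<in> carrier (V_cochains (Suc 3))"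
      using fh by (intro coboundary_V_closed C4.m_closed)
    fix xs :: "(bit ^ 'a) list"
    assume len: "length xs = Suc 3"
    then obtain a b c d where xs: "xs = [a, b, c, d]"
      by (auto simp: numeral_3_eq_3 length_Suc_conv)
    have "(?d f \<otimes>\<^bsub>V_cochains (Suc 3)\<^esub> ?d h) xs = ?d f xs * ?d h xs"
      using len by (simp add: cochain_group_def tuples_V_group unit_group_def)
    then show "?d (f \<otimes>\<^bsub>V_cochains 3\<^esub> h) xs = (?d f \<otimes>\<^bsub>V_cochains (Suc 3)\<^esub> ?d h) xs"
      using fh
      by (simp add: xs coboundary_V_3 curry3_mult cob3_def field_simps)
  qed
qed (rule coboundary_V_closed)

lemma cocycles_V_3:
  "cocycles V_group unit_group 3 =
    {f \<in> carrier (V_cochains 3). \<forall>a b c d. cob3 (curry3 f) a b c d = 0}"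
proof -
  have "coboundary V_group unit_group 3 f = \<one>\<^bsub>V_cochains (Suc 3)\<^esub> \<longleftrightarrow>
      (\<forall>a b c d. cob3 (curry3 f) a b c d = 0)"
    if f: "f \<in> carrier (V_cochains 3)" for f :: "(bit ^ 'a) list \<Rightarrow> 'b"
  proof
    assume eq: "coboundary V_group unit_group 3 f = \<one>\<^bsub>V_cochains (Suc 3)\<^esub>"
    show "\<forall>a b c d. cob3 (curry3 f) a b c d = 0"
    proof (intro allI)
      fix a b c d
      have "unit_val (cob3 (curry3 f) a b c d) = unit_val 0"
        using fun_cong[OF eq, of "[a, b, c, d]"]
        by (simp add: coboundary_V_3[OF f] one_V_cochains)
      then show "cob3 (curry3 f) a b c d = 0"
        by (simp only: unit_val_inject)
    qed
  next
    assume *: "\<forall>a b c d. cob3 (curry3 f) a b c d = 0"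
    show "coboundary V_group unit_group 3 f = \<one>\<^bsub>V_cochains (Suc 3)\<^esub>"
    proof (rule V_cochain_eqI)
      show "coboundary V_group unit_group 3 f \<in> carrier (V_cochains (Suc 3))"
        by (rule coboundary_V_closed[OF f])
      show "\<one>\<^bsub>V_cochains (Suc 3)\<^esub> \<in> carrier (V_cochains (Suc 3))"
        by (rule comm_groupE(2)[OF V_cochains_comm_group])
      fix xs :: "(bit ^ 'a) list"
      assume len: "length xs = Suc 3"
      then obtain a b c d where xs: "xs = [a, b, c, d]"
        by (auto simp: numeral_3_eq_3 length_Suc_conv)
      show "coboundary V_group unit_group 3 f xs = \<one>\<^bsub>V_cochains (Suc 3)\<^esub> xs"
        using * len by (simp add: xs coboundary_V_3[OF f] one_V_cochains)
    qed
  qed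
  then show ?thesis
    unfolding cocycles_def kernel_def by blast
qed

definition V_cocycles :: "((bit ^ 'n) list \<Rightarrow> 'k::field) monoid" where
  "V_cocycles = (V_cochains 3)\<lparr>carrier := cocycles V_group unit_group 3\<rparr>"

lemma V_cocycles_simps [simp]:
  "carrier V_cocycles = cocycles V_group unit_group 3"
  "monoid.mult V_cocycles = monoid.mult (V_cochains 3)"
  "one V_cocycles = one (V_cochains 3)"
  by (simp_all add: V_cocycles_def)

lemma V_cocycles_comm_group: "comm_group V_cocycles"
proof -
  interpret C3: comm_group "V_cochains 3 :: ((bit ^ 'a) list \<Rightarrow> 'b) monoid"
    by (rule V_cochains_comm_group)
  interpret C4: comm_group "V_cochains (Suc 3) :: ((bit ^ 'a) list \<Rightarrow> 'b) monoid"
    by (rule V_cochains_comm_group)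
  interpret group_hom "V_cochains 3 :: ((bit ^ 'a) list \<Rightarrow> 'b) monoid" "V_cochains (Suc 3)"
      "coboundary V_group unit_group 3"
    unfolding group_hom_def group_hom_axioms_def
    using C3.is_group C4.is_group coboundary_3_hom by blast
  have "Group.group (V_cocycles :: ((bit ^ 'a) list \<Rightarrow> 'b) monoid)"
    unfolding V_cocycles_def cocycles_def by (rule C3.subgroup_imp_group[OF subgroup_kernel])
  then show ?thesis
    by (rule group.group_comm_groupI) (auto simp: cocycles_V_3 C3.m_comm)
qed

definition point_functions :: "(bit ^ 'n \<Rightarrow> 'k::field mult_units) monoid" where
  "point_functions = \<lparr>carrier = UNIV, monoid.mult = (\<lambda>F G v. F v + G v), one = (\<lambda>v. 0)\<rparr>"

lemma group_point_functions: "Group.group point_functions"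
  by (rule groupI)
    (auto simp: point_functions_def add.assoc fun_eq_iff intro: exI[of _ "\<lambda>v. - x v" for x])

lemma diagonal_curry3_hom:
  "(\<lambda>f. diagonal (curry3 f)) \<in> hom V_cocycles point_functions"
  by (rule homI)
    (auto simp: point_functions_def cocycles_V_3 diagonal_def curry3_mult algebra_simps)

lemma coboundaries_V_3:
  "coboundaries V_group unit_group 3 = coboundary V_group unit_group 2 ` carrier (V_cochains 2)"
  by (simp add: coboundaries_def numeral_3_eq_3 numeral_2_eq_2)

lemma coboundary_V_2_closed:
  "g \<in> carrier (V_cochains 2) \<Longrightarrow> coboundary V_group unit_group 2 g \<in> carrier (V_cochains 3)"
  using coboundary_V_closed[of g 2] by simp

lemma curry3_coboundary:
  assumes "g \<in> carrier (V_cochains 2)"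
  shows "curry3 (coboundary V_group unit_group 2 g) = cob2 (curry2 g)"
  using unit_val_curry3[OF coboundary_V_2_closed[OF assms]] coboundary_V_2[OF assms]
  by (simp add: fun_eq_iff flip: unit_val_inject)

text \<open>One inclusion is the injectivity of restriction to cyclic subgroups. Having the
  coboundaries as a kernel gives \<open>group_cohomology\<close> the shape required by
  \<open>group_module_isomorphic_quotients\<close>.\<close>

lemma kernel_diagonal:
  "kernel V_cocycles point_functions (\<lambda>f. diagonal (curry3 f)) =
    (coboundaries V_group unit_group 3 :: ((bit ^ 'n) list \<Rightarrow> 'k::alg_closed_field) set)"
proof (intro equalityI subsetI)
  fix f :: "(bit ^ 'n) list \<Rightarrow> 'k"
  assume "f \<in> kernel V_cocycles point_functions (\<lambda>f. diagonal (curry3 f))"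
  then have f: "f \<in> carrier (V_cochains 3)" "\<And>a b c d. cob3 (curry3 f) a b c d = 0"
      "\<And>v. diagonal (curry3 f) v = 0"
    by (auto simp: kernel_def cocycles_V_3 point_functions_def fun_eq_iff)
  obtain g where g: "\<And>u v w. curry3 f u v w = cob2 g u v w"
    using diagonal_zero_imp_coboundary[OF minus_one_unit_add_self mult_units_torsion
        mult_units_divisible f(2,3)] by blast
  have "f = coboundary V_group unit_group 2 (uncurry2 g)"
    using f(1) uncurry2(1) by (rule curry3_eqI[OF _ coboundary_V_2_closed])
      (simp add: curry3_coboundary uncurry2 g)
  then show "f \<in> coboundaries V_group unit_group 3"
    unfolding coboundaries_V_3 using uncurry2(1) by blast
next
  fix f :: "(bit ^ 'n) list \<Rightarrow> 'k"
  assume "f \<in> coboundaries V_group unit_group 3"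
  then obtain g where g: "g \<in> carrier (V_cochains 2)" "f = coboundary V_group unit_group 2 g"
    unfolding coboundaries_V_3 by blast
  then have c: "curry3 f = cob2 (curry2 g)"
    using curry3_coboundary by blast
  have "f \<in> carrier (V_cochains 3)"
    using g coboundary_V_2_closed by blast
  moreover have "diagonal (curry3 f) = (\<lambda>v. 0)"
    by (rule ext) (simp add: c diagonal_cob2 bit_vec_add_self)
  ultimately show "f \<in> kernel V_cocycles point_functions (\<lambda>f. diagonal (curry3 f))"
    by (simp add: kernel_def cocycles_V_3 cob3_cob2 point_functions_def c)
qed

definition poly_sign :: "('n::finite) F2_poly \<Rightarrow> bit ^ 'n \<Rightarrow> 'k::field mult_units" where
  "poly_sign p v = scale_bit (F2_eval p v) minus_one_unit"

lemma S3_group_comm_group: "comm_group S3_group"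
proof (rule comm_groupI)
  fix p :: "('n::finite) F2_poly"
  assume "p \<in> carrier S3_group"
  then show "\<exists>q\<in>carrier S3_group. q \<otimes>\<^bsub>S3_group\<^esub> p = \<one>\<^bsub>S3_group\<^esub>"
    by (intro bexI[of _ p]) (simp_all only: S3_group_def monoid.simps partial_object.simps F2_poly_add_self)
qed (auto simp: S3_group_def add_homogeneous algebra_simps)

lemma poly_sign_hom: "poly_sign \<in> hom S3_group point_functions"
  by (rule homI)
    (simp_all only: S3_group_def point_functions_def monoid.simps partial_object.simps UNIV_I
      poly_sign_def F2_eval_add scale_bit_add_left[OF minus_one_unit_add_self] fun_eq_iff simp_thms)

lemma kernel_poly_sign:
  "kernel S3_group (point_functions :: (_ \<Rightarrow> 'k::field_char_0 mult_units) monoid) poly_sign = S3_relations"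
proof -
  have "scale_bit b (minus_one_unit :: 'k mult_units) = 0 \<longleftrightarrow> b = 0" for b
    by (cases b) (simp_all add: minus_one_unit_neq_0)
  then show ?thesis
    by (auto simp: kernel_def S3_relations_eq S3_group_def point_functions_def poly_sign_def fun_eq_iff)
qed

lemma diagonal_image:
  "(\<lambda>f. diagonal (curry3 f)) ` carrier (V_cocycles :: ((bit ^ 'n) list \<Rightarrow> 'k::alg_closed_field) monoid) =
    poly_sign ` carrier S3_group"
proof (intro equalityI subsetI)
  fix F :: "bit ^ 'n \<Rightarrow> 'k mult_units"
  assume "F \<in> (\<lambda>f. diagonal (curry3 f)) ` carrier V_cocycles"
  then obtain f where f: "\<And>a b c d. cob3 (curry3 f) a b c d = 0" "F = diagonal (curry3 f)"
    by (auto simp: cocycles_V_3)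
  then have "represented 3 minus_one_unit F"
    using diagonal_represented[OF minus_one_unit_add_self mult_units_torsion mult_units_divisible f(1)]
    by simp
  then obtain p where "p \<in> homogeneous_polys 3" "F = poly_sign p"
    by (auto simp: represented_def poly_sign_def[abs_def] fun_eq_iff)
  then show "F \<in> poly_sign ` carrier S3_group"
    by (simp add: S3_group_def)
next
  fix F :: "bit ^ 'n \<Rightarrow> 'k mult_units"
  assume "F \<in> poly_sign ` carrier S3_group"
  then obtain p where p: "p \<in> homogeneous_polys 3" "F = poly_sign p"
    by (auto simp: S3_group_def)
  obtain f where f: "\<And>a b c d. cob3 f a b c d = 0" "\<And>v. diagonal f v = F v"
    using cubic_is_diagonal[OF minus_one_unit_add_self mult_units_torsion p(1)]
    unfolding p(2) poly_sign_def by metis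
  then have "uncurry3 f \<in> carrier V_cocycles" "F = diagonal (curry3 (uncurry3 f))"
    by (auto simp: cocycles_V_3 uncurry3 fun_eq_iff)
  then show "F \<in> (\<lambda>f. diagonal (curry3 f)) ` carrier V_cocycles"
    by blast
qed

section \<open>Equivariance and conclusion\<close>

abbreviation GL_pullback ::
    "bit ^ 'n ^ 'n \<Rightarrow> ((bit ^ 'n) list \<Rightarrow> 'k) \<Rightarrow> (bit ^ 'n) list \<Rightarrow> 'k" where
  "GL_pullback A \<equiv> pullback_cochain V_group 3 (\<lambda>v. matrix_inv A *v v)"

lemma GL_pullback_closed:
  "f \<in> carrier (V_cochains 3) \<Longrightarrow> GL_pullback A f \<in> carrier (V_cochains 3)"
  by (auto simp: pullback_cochain_def cochain_group_def tuples_V_group)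

lemma curry3_pullback:
  "curry3 (pullback_cochain V_group 3 \<alpha> f) u v w = curry3 f (\<alpha> u) (\<alpha> v) (\<alpha> w)"
  by (simp add: curry3_def pullback_cochain_def tuples_V_group)

lemma GL_pullback_hom: "GL_pullback A \<in> hom V_cocycles V_cocycles"
proof (rule homI)
  fix f :: "(bit ^ 'a) list \<Rightarrow> 'b"
  assume f: "f \<in> carrier V_cocycles"
  have "cob3 (curry3 (GL_pullback A f)) a b c d =
      cob3 (curry3 f) (matrix_inv A *v a) (matrix_inv A *v b) (matrix_inv A *v c) (matrix_inv A *v d)"
    for a b c d
    by (simp add: cob3_def curry3_pullback matrix_vector_right_distrib)
  then show "GL_pullback A f \<in> carrier V_cocycles"
    using f by (simp add: cocycles_V_3 GL_pullback_closed)
next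
  fix f h :: "(bit ^ 'a) list \<Rightarrow> 'b"
  assume "f \<in> carrier V_cocycles" "h \<in> carrier V_cocycles"
  show "GL_pullback A (f \<otimes>\<^bsub>V_cocycles\<^esub> h) = GL_pullback A f \<otimes>\<^bsub>V_cocycles\<^esub> GL_pullback A h"
    by (auto simp: pullback_cochain_def cochain_group_def tuples_V_group fun_eq_iff)
qed

lemma GL_poly_action_hom: "GL_poly_action A \<in> hom S3_group S3_group"
  by (rule homI) (auto simp: S3_group_def GL_poly_action_homogeneous GL_poly_action_add)

theorem proposition5p6:
  shows "group_module_isomorphic
    (GL_group :: (bit ^ 'n ^ 'n) monoid)
    (group_cohomology (V_group :: (bit ^ 'n) monoid)
       (unit_group :: 'k::{alg_closed_field, field_char_0} monoid) 3)
    (GL_cohomology_action 3)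
    (S3_quotient :: ('n::finite) F2_poly set monoid)
    GL_S3_quotient_action"
proof -
  let ?Q = "point_functions :: (bit ^ 'n \<Rightarrow> 'k mult_units) monoid"
  let ?\<Psi> = "\<lambda>f :: (bit ^ 'n) list \<Rightarrow> 'k. diagonal (curry3 f)"
  have "group_module_isomorphic (GL_group :: (bit ^ 'n ^ 'n) monoid)
    (V_cocycles Mod kernel V_cocycles ?Q ?\<Psi>) (\<lambda>A c. GL_pullback A ` c)
    (S3_group Mod kernel S3_group ?Q poly_sign) (\<lambda>A c. GL_poly_action A ` c)"
  \<comment> \<open>\<open>U\<close> is the action on functions on V by translating the argument
    with the inverse matrix; both the diagonal and the sign function intertwine with it.\<close>
  proof (rule group_module_isomorphic_quotients[where U = "\<lambda>A F v. F (matrix_inv A *v v)"])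
    show "Group.group (GL_group :: (bit ^ 'n ^ 'n) monoid)"
      by (rule group_GL_group)
    show "comm_group (V_cocycles :: ((bit ^ 'n) list \<Rightarrow> 'k) monoid)"
      by (rule V_cocycles_comm_group)
    show "comm_group (S3_group :: 'n F2_poly monoid)"
      by (rule S3_group_comm_group)
    show "Group.group ?Q"
      by (rule group_point_functions)
    show "?\<Psi> \<in> hom V_cocycles ?Q"
      by (rule diagonal_curry3_hom)
    show "poly_sign \<in> hom S3_group ?Q"
      by (rule poly_sign_hom)
    show "?\<Psi> ` carrier V_cocycles = poly_sign ` carrier S3_group"
      by (rule diagonal_image)
    show "GL_pullback A \<in> hom V_cocycles V_cocycles" for A :: "bit ^ 'n ^ 'n"
      by (rule GL_pullback_hom)
    show "GL_poly_action A \<in> hom S3_group S3_group" for A :: "bit ^ 'n ^ 'n"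
      by (rule GL_poly_action_hom)
    show "GL_pullback \<one>\<^bsub>GL_group\<^esub> f = f" if "f \<in> carrier V_cocycles"
      for f :: "(bit ^ 'n) list \<Rightarrow> 'k"
      using that
      by (intro curry3_eqI GL_pullback_closed)
        (auto simp: cocycles_V_3 curry3_pullback GL_group_def matrix_inv_mat_1)
    show "GL_poly_action \<one>\<^bsub>GL_group\<^esub> p = p" for p :: "'n F2_poly"
      by (simp add: GL_poly_action_eq GL_group_def matrix_inv_mat_1 dual_action_mat_1 substitute_X)
    show "GL_pullback (A \<otimes>\<^bsub>GL_group\<^esub> B) f = GL_pullback A (GL_pullback B f)"
      if "A \<in> carrier GL_group" "B \<in> carrier GL_group" "f \<in> carrier V_cocycles"
      for A B :: "bit ^ 'n ^ 'n" and f :: "(bit ^ 'n) list \<Rightarrow> 'k"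
      using that
      by (intro curry3_eqI GL_pullback_closed)
        (auto simp: cocycles_V_3 curry3_pullback GL_group_def matrix_inv_mult
          matrix_vector_mul_assoc)
    show "GL_poly_action (A \<otimes>\<^bsub>GL_group\<^esub> B) p = GL_poly_action A (GL_poly_action B p)"
      if "A \<in> carrier GL_group" "B \<in> carrier GL_group"
      for A B :: "bit ^ 'n ^ 'n" and p
      using that
      by (simp add: GL_poly_action_eq GL_group_def matrix_inv_mult substitute_dual_action_substitute)
    show "diagonal (curry3 (GL_pullback A f)) = (\<lambda>v. diagonal (curry3 f) (matrix_inv A *v v))"
      for A :: "bit ^ 'n ^ 'n" and f :: "(bit ^ 'n) list \<Rightarrow> 'k"
      by (simp add: diagonal_def curry3_pullback fun_eq_iff)
    show "poly_sign (GL_poly_action A p) = (\<lambda>v. poly_sign p (matrix_inv A *v v) :: 'k mult_units)"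
      for A :: "bit ^ 'n ^ 'n" and p
      by (simp add: poly_sign_def F2_eval_GL_poly_action fun_eq_iff)
  qed
  moreover have action: "GL_cohomology_action 3 =
      (\<lambda>(A :: bit ^ 'n ^ 'n) (c :: ((bit ^ 'n) list \<Rightarrow> 'k) set). GL_pullback A ` c)"
    by (intro ext) (simp add: GL_cohomology_action_def pullback_cohomology_def)
  ultimately show ?thesis
    unfolding kernel_diagonal kernel_poly_sign
    by (simp add: group_cohomology_def V_cocycles_def S3_quotient_def GL_S3_quotient_action_def[abs_def]
        action)
qed

end
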